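(* Let $E$ be a realizable $(0,1,-1)$ matrix of rank $k$, and let $A$ be a $(0,1)$ matrix such that $A+E$ is a $(0,1)$ matrix. Then the following are equivalent: (i) $A$ and $A+E$ are Gram mates and $(2A+E)E^T=0$. (ii) $A$ and $A+E$ are Gram mates and $E^T(2A+E)=0$. (iii) $A+E$ is obtained from $A$ by changing the signs of $k$ positive singular values of $A$. (Here these $k$ positive singular values are the same as the positive singular values of $-\frac{1}{2}E$.) (iv) There exist $k$ right singular vectors $\mathbf v_1,\dots,\mathbf v_k$ of $A$ corresponding to positive singular values such that $\mathbf v_1,\dots,\mathbf v_k$ form a basis of $\mathrm{Row}(E)$ and $(2A+E)\mathbf v_i=0$ for $i=1,\dots,k$. (Here $\mathbf v_1,\dots,\mathbf v_k$ can be obtained from right singular vectors corresponding to the positive singular values of $-\frac{1}{2}E$.) (v) There exist $k$ left singular vectors $\mathbf u_1,\dots,\mathbf u_k$ of $A$ corresponding to positive singular values such that $\mathbf u_1,\dots,\mathbf u_k$ form a basis of $\mathrm{Col}(E)$ and $(2A+E)^T\mathbf u_i=0$ for $i=1,\dots,k$. (Here $\mathbf u_1,\dots,\mathbf u_k$ can be obtained from left singular vectors corresponding to the positive singular values of $-\frac{1}{2}E$.) (vi) $A$ and $A+E$ are Gram mates and $AE^T$ is symmetric. (vii) $A$ and $A+E$ are Gram mates and $A^TE$ is symmetric.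
   Context: Two $(0,1)$ matrices $A,B$ are Gram mates if $AA^T=BB^T$, $A^TA=B^TB$ and $A\neq B$. A $(0,1,-1)$ matrix $E$ with $E\mathbf 1=0$ and $\mathbf 1^TE=0^T$ is realizable if there is a $(0,1)$ matrix $A$ such that $A$ and $A+E$ are Gram mates. For an $m\times n$ real matrix $A$, "$B$ is obtained from $A$ by changing the signs of $k$ positive singular values" means: there are orthogonal $U$ ($m\times m$), $V$ ($n\times n$) and an $m\times n$ rectangular diagonal $\Sigma$ with nonnegative diagonal entries such that $A=U\Sigma V^T$, and an $m\times m$ diagonal matrix $S$ with diagonal entries $\pm1$, exactly $k$ of them equal to $-1$ and each such $-1$ in a position $i$ with $\Sigma_{ii}>0$, such that $B=US\Sigma V^T$. $\mathrm{Row}(E)$, $\mathrm{Col}(E)$ denote the row and column spaces. *)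

theory Defs
  imports "Jordan_Normal_Form.DL_Rank" "Jordan_Normal_Form.VS_Connect" "HOL-Library.Multiset"
begin

definition zero_one_mat :: "real mat \<Rightarrow> bool" where
  "zero_one_mat A \<longleftrightarrow> (\<forall>i<dim_row A. \<forall>j<dim_col A. A $$ (i,j) \<in> {0, 1})"

definition zero_one_neg_mat :: "real mat \<Rightarrow> bool" where
  "zero_one_neg_mat E \<longleftrightarrow> (\<forall>i<dim_row E. \<forall>j<dim_col E. E $$ (i,j) \<in> {-1, 0, 1})"

definition ones_vec :: "nat \<Rightarrow> real vec" where
  "ones_vec n = vec n (\<lambda>_. 1)"

definition gram_mates :: "real mat \<Rightarrow> real mat \<Rightarrow> bool" where
  "gram_mates A B \<longleftrightarrow>
     zero_one_mat A \<and> zero_one_mat B \<and>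
     dim_row A = dim_row B \<and> dim_col A = dim_col B \<and>
     A * A\<^sup>T = B * B\<^sup>T \<and> A\<^sup>T * A = B\<^sup>T * B \<and> A \<noteq> B"

definition realizable :: "real mat \<Rightarrow> bool" where
  "realizable E \<longleftrightarrow>
     zero_one_neg_mat E \<and>
     E *\<^sub>v ones_vec (dim_col E) = 0\<^sub>v (dim_row E) \<and>
     E\<^sup>T *\<^sub>v ones_vec (dim_row E) = 0\<^sub>v (dim_col E) \<and>
     (\<exists>A. A \<in> carrier_mat (dim_row E) (dim_col E) \<and> zero_one_mat A \<and> gram_mates A (A + E))"

definition orthogonal_matrix_of :: "nat \<Rightarrow> real mat \<Rightarrow> bool" where
  "orthogonal_matrix_of n U \<longleftrightarrow> U \<in> carrier_mat n n \<and> U\<^sup>T * U = 1\<^sub>m n"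

definition is_svd :: "real mat \<Rightarrow> real mat \<Rightarrow> real mat \<Rightarrow> real mat \<Rightarrow> bool" where
  "is_svd M U Sig V \<longleftrightarrow>
     (let m = dim_row M; n = dim_col M in
       orthogonal_matrix_of m U \<and> orthogonal_matrix_of n V \<and>
       Sig \<in> carrier_mat m n \<and>
       (\<forall>i<m. \<forall>j<n. i \<noteq> j \<longrightarrow> Sig $$ (i,j) = 0) \<and>
       (\<forall>i<min m n. Sig $$ (i,i) \<ge> 0) \<and>
       M = U * Sig * V\<^sup>T)"

definition sign_flip_mat :: "nat \<Rightarrow> nat \<Rightarrow> real mat \<Rightarrow> real mat \<Rightarrow> bool" where
  "sign_flip_mat k m Sig S \<longleftrightarrow>
     S \<in> carrier_mat m m \<and>
     (\<forall>i<m. \<forall>j<m. i \<noteq> j \<longrightarrow> S $$ (i,j) = 0) \<and>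
     (\<forall>i<m. S $$ (i,i) = 1 \<or> S $$ (i,i) = -1) \<and>
     card {i. i < m \<and> S $$ (i,i) = -1} = k \<and>
     (\<forall>i<m. S $$ (i,i) = -1 \<longrightarrow> i < dim_col Sig \<and> Sig $$ (i,i) > 0)"

definition sign_change_witness :: "real mat \<Rightarrow> real mat \<Rightarrow> nat \<Rightarrow> real mat \<Rightarrow> real mat \<Rightarrow> real mat \<Rightarrow> real mat \<Rightarrow> bool" where
  "sign_change_witness A B k U Sig V S \<longleftrightarrow>
     is_svd A U Sig V \<and> sign_flip_mat k (dim_row A) Sig S \<and> B = U * S * Sig * V\<^sup>T"

definition obtained_by_sign_change :: "real mat \<Rightarrow> real mat \<Rightarrow> nat \<Rightarrow> bool" where
  "obtained_by_sign_change A B k \<longleftrightarrow> (\<exists>U Sig V S. sign_change_witness A B k U Sig V S)"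

definition flipped_values :: "real mat \<Rightarrow> real mat \<Rightarrow> real multiset" where
  "flipped_values Sig S = image_mset (\<lambda>i. Sig $$ (i,i)) (mset_set {i. i < dim_row S \<and> S $$ (i,i) = -1})"

definition positive_diag :: "real mat \<Rightarrow> real multiset" where
  "positive_diag Sig = image_mset (\<lambda>i. Sig $$ (i,i))
       (mset_set {i. i < min (dim_row Sig) (dim_col Sig) \<and> Sig $$ (i,i) > 0})"

definition right_sing_vec_pos :: "real mat \<Rightarrow> real vec \<Rightarrow> bool" where
  "right_sing_vec_pos A v \<longleftrightarrow> v \<in> carrier_vec (dim_col A) \<and> v \<bullet> v = 1 \<and>
     (\<exists>s u. s > 0 \<and> u \<in> carrier_vec (dim_row A) \<and> u \<bullet> u = 1 \<and>
        A *\<^sub>v v = s \<cdot>\<^sub>v u \<and> A\<^sup>T *\<^sub>v u = s \<cdot>\<^sub>v v)"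

definition left_sing_vec_pos :: "real mat \<Rightarrow> real vec \<Rightarrow> bool" where
  "left_sing_vec_pos A u \<longleftrightarrow> u \<in> carrier_vec (dim_row A) \<and> u \<bullet> u = 1 \<and>
     (\<exists>s v. s > 0 \<and> v \<in> carrier_vec (dim_col A) \<and> v \<bullet> v = 1 \<and>
        A *\<^sub>v v = s \<cdot>\<^sub>v u \<and> A\<^sup>T *\<^sub>v u = s \<cdot>\<^sub>v v)"

definition is_basis_of :: "nat \<Rightarrow> real vec list \<Rightarrow> real vec set \<Rightarrow> bool" where
  "is_basis_of n vs W \<longleftrightarrow> distinct vs \<and> set vs \<subseteq> carrier_vec n \<and>
     LinearCombinations.module.lin_indpt class_ring (module_vec TYPE(real) n) (set vs) \<and>
     LinearCombinations.module.span class_ring (module_vec TYPE(real) n) (set vs) = W"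

abbreviation Row :: "real mat \<Rightarrow> real vec set" where
  "Row E \<equiv> vec_space.row_space (dim_col E) E"

abbreviation Col :: "real mat \<Rightarrow> real vec set" where
  "Col E \<equiv> vec_space.col_space (dim_row E) E"

end

theory Submission
  imports Defs "Jordan_Normal_Form.Schur_Decomposition"
begin

text \<open>
  Write \<open>F = -E/2\<close> and \<open>C = A + E/2\<close>, so that \<open>A = C + F\<close> and \<open>A + E = C - F\<close>. All conditions say that
  \<open>F\<close> and \<open>C\<close> are orthogonal on both sides, \<open>C F\<^sup>T = 0\<close> and \<open>F\<^sup>T C = 0\<close>. Under this orthogonality, singular
  systems of \<open>F\<close> and \<open>C\<close> concatenate to one of \<open>A\<close>, and replacing \<open>F\<close> by \<open>-F\<close> flips exactly the
  \<open>rank F\<close> singular values that come from \<open>F\<close>. Conversely, a sign change splits \<open>A\<close> into the flipped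
  part \<open>F\<close> and the unflipped part \<open>C\<close>, and the positive singular values of \<open>F\<close> are unique because their
  squares are the positive roots of the characteristic polynomial of \<open>F F\<^sup>T\<close>.
  Singular systems exist since the symmetric matrix \<open>M\<^sup>T M\<close> has positive trace for \<open>M \<noteq> 0\<close>, hence a nonzero
  eigenvalue, and a maximal system exhausts \<open>M\<close> by deflation.
\<close>

section \<open>Eigenvectors of real symmetric matrices\<close>

text \<open>The factor 1/2 appears because \<open>C\<close> and \<open>F\<close> are the half sum
  and half difference of \<open>A\<close> and \<open>A + E\<close>; changing the signs of some
  singular values fixes one part and negates the other. The obstacle is that (i), (ii), (iv) and (v)
  each state orthogonality on one side only. In (i) and (ii) the missing side comes from the Gram
  equations, which make a certain product skew-symmetric. In (iv) and (v) Gram mates are not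
  assumed, so the missing side has to be extracted from the singular vector equations, and the Gram
  equations are then recovered from the two orthogonality relations. Constructions use lists of
  singular triples with positive values instead of full decompositions: such lists can be
  concatenated and restricted to a summand, and they are completed to orthogonal matrices only at
  the end.\<close>

lemma scalar_prod_self_nonneg: "0 \<le> x \<bullet> (x :: real vec)"
  by (simp add: scalar_prod_def sum_nonneg)

lemma scalar_prod_self_eq_0_iff:
  fixes x :: "real vec"
  assumes "x \<in> carrier_vec n"
  shows "x \<bullet> x = 0 \<longleftrightarrow> x = 0\<^sub>v n"
proof
  assume "x \<bullet> x = 0"
  then have "\<forall>i\<in>{0..<dim_vec x}. x $ i * x $ i = 0"
    unfolding scalar_prod_def by (subst (asm) sum_nonneg_eq_0_iff) auto
  then show "x = 0\<^sub>v n" using assms by (intro eq_vecI) auto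
qed (use assms in auto)

lemma exists_unit_multiple:
  fixes x :: "real vec"
  assumes x: "x \<in> carrier_vec n" and "x \<noteq> 0\<^sub>v n"
  obtains c where "(c \<cdot>\<^sub>v x) \<bullet> (c \<cdot>\<^sub>v x) = 1"
proof -
  have pos: "x \<bullet> x > 0"
    using assms scalar_prod_self_nonneg[of x] scalar_prod_self_eq_0_iff[OF x] by linarith
  then have "(1 / sqrt (x \<bullet> x)) * ((1 / sqrt (x \<bullet> x)) * (x \<bullet> x)) = 1"
    by (simp add: divide_simps)
  then show ?thesis by (intro that[of "1 / sqrt (x \<bullet> x)"]) simp
qed

lemma scalar_prod_mult_mat_vec_transpose:
  fixes M :: "real mat"
  assumes "M \<in> carrier_mat m n" "x \<in> carrier_vec n" "y \<in> carrier_vec m"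
  shows "(M *\<^sub>v x) \<bullet> y = x \<bullet> (M\<^sup>T *\<^sub>v y)"
  using transpose_vec_mult_scalar[OF assms] assms
  by (metis comm_scalar_prod mult_mat_vec_carrier transpose_carrier_mat)

text \<open>Polymorphic because it is applied both to a real matrix and to its
  complexification.\<close>

definition mat_trace :: "'a :: comm_semiring_0 mat \<Rightarrow> 'a" where
  "mat_trace N = (\<Sum>i<dim_row N. N $$ (i,i))"

lemma mat_trace_mult_comm:
  assumes "P \<in> carrier_mat n m" "Q \<in> carrier_mat m n"
  shows "mat_trace (P * Q) = mat_trace (Q * P)"
proof -
  have "mat_trace (P * Q) = (\<Sum>i<n. \<Sum>j<m. P $$ (i,j) * Q $$ (j,i))"
    unfolding mat_trace_def using assms
    by (intro sum.cong) (auto simp: scalar_prod_def atLeast0LessThan)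
  also have "\<dots> = (\<Sum>j<m. \<Sum>i<n. Q $$ (j,i) * P $$ (i,j))"
    by (subst sum.swap) (simp add: mult.commute)
  also have "\<dots> = mat_trace (Q * P)"
    unfolding mat_trace_def using assms
    by (intro sum.cong) (auto simp: scalar_prod_def atLeast0LessThan)
  finally show ?thesis .
qed

text \<open>Over the complex numbers a Schur triangularization exists. The trace is invariant under
  similarity, so it is the sum of the diagonal of the triangular form, that is, of the eigenvalues;
  a nonzero sum has a nonzero term.\<close>

lemma nonzero_eigenvalue_if_trace_nonzero:
  fixes N :: "complex mat"
  assumes N: "N \<in> carrier_mat n n" and tr: "mat_trace N \<noteq> 0"
  obtains e where "e \<noteq> 0" "eigenvalue N e"
proof -
  obtain es where es: "char_poly N = (\<Prod>a\<leftarrow>es. [:- a, 1:])"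
    using char_poly_factorized[OF N] by blast
  obtain B P Q where "schur_decomposition N es = (B,P,Q)" by (metis prod_cases3)
  from schur_decomposition[OF N es this]
  have sim: "similar_mat_wit N B P Q" and B: "diag_mat B = es" by auto
  from sim have c: "B \<in> carrier_mat n n" "P \<in> carrier_mat n n" "Q \<in> carrier_mat n n"
    and QP: "Q * P = 1\<^sub>m n" and NB: "N = P * B * Q"
    using N unfolding similar_mat_wit_def Let_def by auto
  have "mat_trace N = mat_trace (Q * (P * B))"
    unfolding NB using c by (intro mat_trace_mult_comm[of _ n n]) auto
  also have "Q * (P * B) = B"
    using c QP by (simp flip: assoc_mult_mat[of Q n n P n B n])
  also have "mat_trace B = sum_list (diag_mat B)"
    by (simp add: mat_trace_def diag_mat_def sum_list_sum_nth atLeast0LessThan)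
  finally have "sum_list es \<noteq> 0" using tr B by simp
  moreover have "sum_list xs = 0" if "\<forall>e\<in>set xs. e = 0" for xs :: "complex list"
    using that by (induction xs) auto
  ultimately obtain e where e: "e \<in> set es" "e \<noteq> 0" by blast
  have "poly (char_poly N) e = 0"
    unfolding es poly_prod_list using e(1) by (auto simp: prod_list_zero_iff image_iff)
  then show ?thesis using that e(2) eigenvalue_root_char_poly[OF N] by blast
qed

text \<open>A complex eigenvector is split into its real part \<open>x\<close> and imaginary part
  \<open>y\<close>. Symmetry forces the eigenvalue to be real, and then each nonzero part is a real
  eigenvector.\<close>

lemma symmetric_unit_eigenvector:
  fixes N :: "real mat"
  assumes N: "N \<in> carrier_mat n n" and sym: "N\<^sup>T = N" and tr: "mat_trace N \<noteq> 0"
  obtains a x where "a \<noteq> 0" "x \<in> carrier_vec n" "x \<bullet> x = 1" "N *\<^sub>v x = a \<cdot>\<^sub>v x"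
proof -
  let ?N = "map_mat complex_of_real N"
  have "mat_trace ?N = complex_of_real (mat_trace N)"
    using N by (simp add: mat_trace_def)
  then obtain e where e: "e \<noteq> 0" "eigenvalue ?N e"
    using nonzero_eigenvalue_if_trace_nonzero[of ?N n] N tr by auto
  then obtain z where z: "z \<in> carrier_vec n" "z \<noteq> 0\<^sub>v n" and Nz: "?N *\<^sub>v z = e \<cdot>\<^sub>v z"
    using N unfolding eigenvalue_def eigenvector_def by auto
  define x y where "x = map_vec Re z" and "y = map_vec Im z"
  have xy: "x \<in> carrier_vec n" "y \<in> carrier_vec n" using z by (auto simp: x_def y_def)
  have comp: "(\<Sum>j<n. complex_of_real (N $$ (i,j)) * z $ j) = e * z $ i" if "i < n" for i
    using arg_cong[OF Nz, of "\<lambda>w. w $ i"] that N z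
    by (simp add: scalar_prod_def atLeast0LessThan)
  have Nx: "N *\<^sub>v x = Re e \<cdot>\<^sub>v x - Im e \<cdot>\<^sub>v y"
    using N z xy arg_cong[OF comp, of _ Re]
    by (intro eq_vecI) (auto simp: scalar_prod_def x_def y_def atLeast0LessThan)
  have Ny: "N *\<^sub>v y = Im e \<cdot>\<^sub>v x + Re e \<cdot>\<^sub>v y"
    using N z xy arg_cong[OF comp, of _ Im]
    by (intro eq_vecI) (auto simp: scalar_prod_def x_def y_def atLeast0LessThan)
  have nz: "x \<noteq> 0\<^sub>v n \<or> y \<noteq> 0\<^sub>v n"
  proof (rule ccontr)
    assume "\<not> ?thesis"
    then have "z $ i = 0" if "i < n" for i
      using that z by (metis carrier_vecD complex_eqI index_map_vec(1) index_zero_vec(1) x_def y_def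
          zero_complex.simps)
    with z show False by (auto intro!: eq_vecI)
  qed
  \<comment> \<open>Expanding both sides of this symmetry leaves \<open>Im e\<close> times the
    squared norm of the complex eigenvector, which must therefore vanish.\<close>
  have "(N *\<^sub>v x) \<bullet> y = x \<bullet> (N *\<^sub>v y)"
    using scalar_prod_mult_mat_vec_transpose[OF N xy] sym by simp
  then have "Re e * (x \<bullet> y) - Im e * (y \<bullet> y) = Im e * (x \<bullet> x) + Re e * (x \<bullet> y)"
    unfolding Nx Ny using xy
    by (simp add: minus_scalar_prod_distrib[of _ n] scalar_prod_add_distrib[of _ n])
  then have "Im e * (x \<bullet> x + y \<bullet> y) = 0" by (simp add: algebra_simps)
  moreover have "x \<bullet> x + y \<bullet> y \<noteq> 0"
    using nz scalar_prod_self_nonneg[of x] scalar_prod_self_nonneg[of y]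
      scalar_prod_self_eq_0_iff[OF xy(1)] scalar_prod_self_eq_0_iff[OF xy(2)] by linarith
  ultimately have im: "Im e = 0" by simp
  then have a: "Re e \<noteq> 0" using e by (simp add: complex_eq_iff)
  have "\<exists>w. w \<in> carrier_vec n \<and> w \<noteq> 0\<^sub>v n \<and> N *\<^sub>v w = Re e \<cdot>\<^sub>v w"
  proof -
    have "N *\<^sub>v x = Re e \<cdot>\<^sub>v x" "N *\<^sub>v y = Re e \<cdot>\<^sub>v y"
      unfolding Nx Ny im using xy by (auto intro!: eq_vecI)
    then show ?thesis using nz xy by blast
  qed
  then obtain w where w: "w \<in> carrier_vec n" "w \<noteq> 0\<^sub>v n" "N *\<^sub>v w = Re e \<cdot>\<^sub>v w" by blast
  obtain c where "(c \<cdot>\<^sub>v w) \<bullet> (c \<cdot>\<^sub>v w) = 1" using exists_unit_multiple[OF w(1,2)] .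
  moreover have "N *\<^sub>v (c \<cdot>\<^sub>v w) = Re e \<cdot>\<^sub>v (c \<cdot>\<^sub>v w)"
    using mult_mat_vec[OF N w(1)] w(3) by (simp add: smult_smult_assoc mult.commute)
  ultimately show ?thesis by (intro that[OF a, of "c \<cdot>\<^sub>v w"]) (use w in auto)
qed

lemma mult_transpose_self_eq_0:
  fixes K :: "real mat"
  assumes K: "K \<in> carrier_mat m n" and "K * K\<^sup>T = 0\<^sub>m m m"
  shows "K = 0\<^sub>m m n"
proof (rule eq_rowI)
  fix i assume "i < dim_row (0\<^sub>m m n :: real mat)"
  then have i: "i < m" by simp
  have "row K i \<bullet> row K i = (K * K\<^sup>T) $$ (i,i)" using K i by simp
  also have "\<dots> = 0" using assms i by simp
  finally show "row K i = row (0\<^sub>m m n) i"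
    using scalar_prod_self_eq_0_iff[of "row K i" n] K i by simp
qed (use K in auto)

text \<open>A unit eigenvector \<open>x\<close> of \<open>M\<^sup>T * M\<close> with nonzero
  eigenvalue \<open>a\<close> satisfies
  \<open>a = (M *\<^sub>v x) \<bullet> (M *\<^sub>v x)\<close>, so \<open>a\<close> is positive. Its
  square root is the singular value, and the normalized image of \<open>x\<close> is the left
  vector.\<close>

lemma exists_singular_triple:
  fixes M :: "real mat"
  assumes M: "M \<in> carrier_mat m n" and nz: "M \<noteq> 0\<^sub>m m n"
  obtains s u v where "s > 0" "u \<in> carrier_vec m" "v \<in> carrier_vec n" "u \<bullet> u = 1" "v \<bullet> v = 1"
    "M *\<^sub>v v = s \<cdot>\<^sub>v u" "M\<^sup>T *\<^sub>v u = s \<cdot>\<^sub>v v"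
proof -
  let ?N = "M\<^sup>T * M"
  have N: "?N \<in> carrier_mat n n" and MT: "M\<^sup>T \<in> carrier_mat n m" using M by auto
  have "mat_trace ?N = (\<Sum>j<n. col M j \<bullet> col M j)" using M by (simp add: mat_trace_def)
  moreover have "(\<Sum>j<n. col M j \<bullet> col M j) \<noteq> 0"
  proof
    assume "(\<Sum>j<n. col M j \<bullet> col M j) = 0"
    then have "\<forall>j\<in>{..<n}. col M j \<bullet> col M j = 0"
      by (subst (asm) sum_nonneg_eq_0_iff) (auto simp: scalar_prod_self_nonneg)
    then have "col M j = 0\<^sub>v m" if "j < n" for j
      using that M scalar_prod_self_eq_0_iff[of "col M j" m] by auto
    then have "M $$ (i,j) = 0" if "i < m" "j < n" for i j
      using that M by (metis carrier_matD index_col index_zero_vec(1))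
    then have "M = 0\<^sub>m m n" using M by (intro eq_matI) auto
    with nz show False ..
  qed
  moreover have "?N\<^sup>T = ?N" using transpose_mult[OF MT M] by simp
  ultimately obtain a x where a: "a \<noteq> 0" and x: "x \<in> carrier_vec n" "x \<bullet> x = 1"
    and Nx: "?N *\<^sub>v x = a \<cdot>\<^sub>v x"
    using symmetric_unit_eigenvector[OF N] by metis
  have Mx: "M *\<^sub>v x \<in> carrier_vec m" using M x by simp
  have MMx: "M\<^sup>T *\<^sub>v (M *\<^sub>v x) = a \<cdot>\<^sub>v x" using Nx M MT x by simp
  have Mxa: "(M *\<^sub>v x) \<bullet> (M *\<^sub>v x) = a"
    using scalar_prod_mult_mat_vec_transpose[OF M x(1) Mx] MMx x by simp
  then have pos: "a > 0" using a scalar_prod_self_nonneg[of "M *\<^sub>v x"] by linarith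
  define s where "s = sqrt a"
  have s: "s > 0" "s * s = a" using pos by (auto simp: s_def)
  define u where "u = (1/s) \<cdot>\<^sub>v (M *\<^sub>v x)"
  show ?thesis
  proof (rule that[OF s(1) _ x(1) _ x(2)])
    show "u \<in> carrier_vec m" using Mx by (simp add: u_def)
    have "1/s * (1/s * a) = 1" and as: "1/s * a = s" using s by (auto simp: field_simps)
    then show "u \<bullet> u = 1" using Mxa by (simp add: u_def)
    show "M *\<^sub>v x = s \<cdot>\<^sub>v u" using s by (simp add: u_def smult_smult_assoc)
    have "M\<^sup>T *\<^sub>v u = (1/s * a) \<cdot>\<^sub>v x"
      unfolding u_def mult_mat_vec[OF MT Mx] MMx smult_smult_assoc ..
    then show "M\<^sup>T *\<^sub>v u = s \<cdot>\<^sub>v x" unfolding as .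
  qed
qed

section \<open>Orthonormal families\<close>

text \<open>A function on an initial segment of indices, with arbitrary values from \<open>r\<close>
  on: adding a vector is a function update, and joining two families is an index shift.\<close>

definition orthonormal_family :: "nat \<Rightarrow> nat \<Rightarrow> (nat \<Rightarrow> real vec) \<Rightarrow> bool" where
  "orthonormal_family n r u \<longleftrightarrow> (\<forall>i<r. u i \<in> carrier_vec n) \<and>
     (\<forall>i<r. \<forall>j<r. u i \<bullet> u j = (if i = j then 1 else 0))"

definition family_mat :: "nat \<Rightarrow> nat \<Rightarrow> (nat \<Rightarrow> real vec) \<Rightarrow> real mat" where
  "family_mat n r u = mat_of_cols n (map u [0..<r])"

lemma family_mat_carrier [simp]: "family_mat n r u \<in> carrier_mat n r"
  "dim_row (family_mat n r u) = n" "dim_col (family_mat n r u) = r"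
  by (auto simp: family_mat_def)

lemma col_family_mat:
  assumes "orthonormal_family n r u" "i < r"
  shows "col (family_mat n r u) i = u i"
  using assms by (simp add: family_mat_def orthonormal_family_def)

lemma cols_family_mat:
  assumes "orthonormal_family n r u"
  shows "cols (family_mat n r u) = map u [0..<r]"
  using assms unfolding family_mat_def orthonormal_family_def
  by (intro cols_mat_of_cols) auto

lemma family_mat_transpose_mult:
  assumes "orthonormal_family n r u"
  shows "(family_mat n r u)\<^sup>T * family_mat n r u = 1\<^sub>m r"
  using assms col_family_mat[OF assms]
  by (intro eq_matI) (auto simp: orthonormal_family_def)

lemma family_mat_transpose_mult_vec:
  assumes "orthonormal_family n r u" "x \<in> carrier_vec n"
  shows "(family_mat n r u)\<^sup>T *\<^sub>v x = vec r (\<lambda>i. u i \<bullet> x)"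
  using assms col_family_mat[OF assms(1)] by (intro eq_vecI) auto

lemma family_mat_mult_vec_inject:
  assumes u: "orthonormal_family n r u" and x: "x \<in> carrier_vec r"
    and 0: "family_mat n r u *\<^sub>v x = 0\<^sub>v n"
  shows "x = 0\<^sub>v r"
proof -
  have "x = ((family_mat n r u)\<^sup>T * family_mat n r u) *\<^sub>v x"
    using x by (simp add: family_mat_transpose_mult[OF u])
  also have "\<dots> = (family_mat n r u)\<^sup>T *\<^sub>v 0\<^sub>v n"
    using x 0 by (subst assoc_mult_mat_vec[of _ r n _ r]) auto
  also have "\<dots> = 0\<^sub>v r"
    by (rule eq_vecI) auto
  finally show ?thesis .
qed

section \<open>Completing orthonormal families to orthonormal bases\<close>

lemma wide_mat_kernel_nonzero:
  fixes M :: "real mat"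
  assumes M: "M \<in> carrier_mat r n" and "r < n"
  obtains x where "x \<in> carrier_vec n" "x \<noteq> 0\<^sub>v n" "M *\<^sub>v x = 0\<^sub>v r"
proof -
  \<comment> \<open>Padding with zero rows gives a square matrix. Its row \<open>r\<close> is zero
    since \<open>r < n\<close>, so the transpose kills \<open>unit_vec n r\<close>, the determinant
    is zero, and \<open>N\<close> has a kernel vector.\<close>
  define N where "N = mat n n (\<lambda>(i,j). if i < r then M $$ (i,j) else 0)"
  have N: "N \<in> carrier_mat n n" "N\<^sup>T \<in> carrier_mat n n" by (auto simp: N_def)
  have "N\<^sup>T *\<^sub>v unit_vec n r = 0\<^sub>v n"
    using assms by (intro eq_vecI) (auto simp: N_def)
  moreover have "unit_vec n r \<noteq> (0\<^sub>v n :: real vec)"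
    using assms by (metis index_unit_vec(2) index_zero_vec(1) zero_neq_one)
  ultimately have "det (N\<^sup>T) = 0"
    using det_0_iff_vec_prod_zero[OF N(2)] unit_vec_carrier by blast
  then have "det N = 0" using det_transpose[OF N(1)] by simp
  then obtain x where x: "x \<in> carrier_vec n" "x \<noteq> 0\<^sub>v n" "N *\<^sub>v x = 0\<^sub>v n"
    using det_0_iff_vec_prod_zero[OF N(1)] by blast
  have "row M i \<bullet> x = 0" if "i < r" for i
  proof -
    have "row M i = row N i" using that assms by (intro eq_vecI) (auto simp: N_def)
    then show ?thesis
      using arg_cong[OF x(3), of "\<lambda>w. w $ i"] that assms(2) N by simp
  qed
  then have "M *\<^sub>v x = 0\<^sub>v r" using M by (intro eq_vecI) auto
  with x show ?thesis using that by blast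
qed

lemma orthonormal_family_le:
  assumes u: "orthonormal_family n r u"
  shows "r \<le> n"
proof (rule ccontr)
  assume "\<not> r \<le> n"
  then obtain x where "x \<in> carrier_vec r" "x \<noteq> 0\<^sub>v r" "family_mat n r u *\<^sub>v x = 0\<^sub>v n"
    using wide_mat_kernel_nonzero[OF family_mat_carrier(1), of n r] by (metis not_le)
  then show False using family_mat_mult_vec_inject[OF u] by blast
qed

lemma orthonormal_family_Suc:
  assumes u: "orthonormal_family n r u" and x: "x \<in> carrier_vec n" "x \<bullet> x = 1"
    and 0: "\<And>i. i < r \<Longrightarrow> u i \<bullet> x = 0"
  shows "orthonormal_family n (Suc r) (u(r := x))"
  unfolding orthonormal_family_def
proof (intro conjI allI impI)
  fix i j assume ij: "i < Suc r" "j < Suc r"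
  have "x \<bullet> u i = 0" if "i < r" for i
    using 0[OF that] u that x(1) comm_scalar_prod[of x n "u i"]
    by (auto simp: orthonormal_family_def)
  then show "(u(r := x)) i \<bullet> (u(r := x)) j = (if i = j then 1 else 0)"
    using ij u x 0 by (auto simp: orthonormal_family_def less_Suc_eq)
qed (use u x in \<open>auto simp: orthonormal_family_def less_Suc_eq\<close>)

lemma orthonormal_family_extend:
  assumes u: "orthonormal_family n r u"
  obtains w where "orthonormal_family n n w" "\<And>i. i < r \<Longrightarrow> w i = u i"
proof -
  have "\<exists>w. orthonormal_family n n w \<and> (\<forall>i<r. w i = u i)"
    using orthonormal_family_le[OF u] u
  \<comment> \<open>The induction descends from \<open>n\<close>: in the step \<open>r < n\<close>,
    so some unit vector is orthogonal to the family, and the enlarged family is completed by the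
    induction hypothesis.\<close>
  proof (induction r arbitrary: u rule: inc_induct)
    case base
    then show ?case by blast
  next
    case (step r)
    have U: "(family_mat n r u)\<^sup>T \<in> carrier_mat r n" by simp
    obtain y where y: "y \<in> carrier_vec n" "y \<noteq> 0\<^sub>v n" "(family_mat n r u)\<^sup>T *\<^sub>v y = 0\<^sub>v r"
      using wide_mat_kernel_nonzero[OF U step.hyps(2)] .
    obtain c where c: "(c \<cdot>\<^sub>v y) \<bullet> (c \<cdot>\<^sub>v y) = 1" using exists_unit_multiple[OF y(1,2)] .
    have "u i \<bullet> (c \<cdot>\<^sub>v y) = 0" if "i < r" for i
      using arg_cong[OF y(3)[unfolded family_mat_transpose_mult_vec[OF step.prems y(1)]],
          of "\<lambda>w. w $ i"] that y(1) step.prems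
      by (simp add: orthonormal_family_def)
    then have "orthonormal_family n (Suc r) (u(r := c \<cdot>\<^sub>v y))"
      using step.prems y c by (intro orthonormal_family_Suc) auto
    from step.IH[OF this] show ?case by (metis fun_upd_other less_Suc_eq nat_neq_iff)
  qed
  then show ?thesis using that by blast
qed

lemma orthogonal_family_mat:
  assumes "orthonormal_family n n u"
  shows "orthogonal_matrix_of n (family_mat n n u)"
  using family_mat_transpose_mult[OF assms] by (simp add: orthogonal_matrix_of_def)

section \<open>Singular systems\<close>

definition singular_system ::
    "real mat \<Rightarrow> nat \<Rightarrow> (nat \<Rightarrow> real) \<Rightarrow> (nat \<Rightarrow> real vec) \<Rightarrow> (nat \<Rightarrow> real vec) \<Rightarrow> bool" where
  "singular_system M r s u v \<longleftrightarrow>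
     orthonormal_family (dim_row M) r u \<and> orthonormal_family (dim_col M) r v \<and>
     (\<forall>i<r. s i > 0 \<and> M *\<^sub>v v i = s i \<cdot>\<^sub>v u i \<and> M\<^sup>T *\<^sub>v u i = s i \<cdot>\<^sub>v v i)"

text \<open>Fullness says that no positive singular value is missed. It is phrased through the
  kernel, so that it can be checked vector by vector; that the length is then the rank is a later
  consequence.\<close>

definition full_singular_system ::
    "real mat \<Rightarrow> nat \<Rightarrow> (nat \<Rightarrow> real) \<Rightarrow> (nat \<Rightarrow> real vec) \<Rightarrow> (nat \<Rightarrow> real vec) \<Rightarrow> bool" where
  "full_singular_system M r s u v \<longleftrightarrow> singular_system M r s u v \<and>
     (\<forall>x\<in>carrier_vec (dim_col M). (\<forall>i<r. v i \<bullet> x = 0) \<longrightarrow> M *\<^sub>v x = 0\<^sub>v (dim_row M))"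

text \<open>The sum of the rank-one matrices \<open>s i\<close> times \<open>u i\<close> times the
  transpose of \<open>v i\<close>, that is, the part of a singular value decomposition carried by
  the given triples.\<close>

definition outer_sum ::
    "nat \<Rightarrow> nat \<Rightarrow> nat \<Rightarrow> (nat \<Rightarrow> real) \<Rightarrow> (nat \<Rightarrow> real vec) \<Rightarrow> (nat \<Rightarrow> real vec) \<Rightarrow> real mat" where
  "outer_sum m n r s u v = mat m n (\<lambda>(a,b). \<Sum>i<r. s i * (u i $ a * v i $ b))"

lemma outer_sum_carrier: "outer_sum m n r s u v \<in> carrier_mat m n"
  by (simp add: outer_sum_def)

lemma outer_sum_transpose: "(outer_sum m n r s u v)\<^sup>T = outer_sum n m r s v u"
  by (rule eq_matI) (auto simp: outer_sum_def mult.commute)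

lemma outer_sum_mult_vec:
  assumes x: "x \<in> carrier_vec n"
  shows "outer_sum m n r s u v *\<^sub>v x = vec m (\<lambda>a. \<Sum>i<r. s i * (u i $ a * (v i \<bullet> x)))"
proof (rule eq_vecI)
  fix a assume "a < dim_vec (vec m (\<lambda>a. \<Sum>i<r. s i * (u i $ a * (v i \<bullet> x))))"
  then have a: "a < m" by simp
  have "(outer_sum m n r s u v *\<^sub>v x) $ a = (\<Sum>b<n. \<Sum>i<r. s i * (u i $ a * v i $ b) * x $ b)"
    using a x by (simp add: outer_sum_def scalar_prod_def atLeast0LessThan sum_distrib_right)
  also have "\<dots> = (\<Sum>i<r. s i * (u i $ a * (v i \<bullet> x)))"
    using x by (subst sum.swap)
      (simp add: scalar_prod_def atLeast0LessThan sum_distrib_left mult.assoc)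
  finally show "(outer_sum m n r s u v *\<^sub>v x) $ a = vec m (\<lambda>a. \<Sum>i<r. s i * (u i $ a * (v i \<bullet> x))) $ a"
    using a by simp
qed (simp add: outer_sum_def)

lemma outer_sum_mult_member:
  assumes "orthonormal_family n r v" "u i \<in> carrier_vec m" "i < r"
  shows "outer_sum m n r s u v *\<^sub>v v i = s i \<cdot>\<^sub>v u i"
proof -
  have v: "v i \<in> carrier_vec n" using assms by (simp add: orthonormal_family_def)
  have "(\<Sum>j<r. s j * (u j $ a * (v j \<bullet> v i))) = s i * u i $ a" for a
  proof -
    have "(\<Sum>j<r. s j * (u j $ a * (v j \<bullet> v i))) = (\<Sum>j<r. if j = i then s j * u j $ a else 0)"
      using assms by (intro sum.cong) (auto simp: orthonormal_family_def)
    then show ?thesis using assms by simp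
  qed
  then show ?thesis unfolding outer_sum_mult_vec[OF v] using assms by (intro eq_vecI) auto
qed

lemma outer_sum_mult_orthogonal:
  assumes "x \<in> carrier_vec n" "\<And>i. i < r \<Longrightarrow> v i \<bullet> x = 0"
  shows "outer_sum m n r s u v *\<^sub>v x = 0\<^sub>v m"
  unfolding outer_sum_mult_vec[OF assms(1)] using assms by (intro eq_vecI) auto

text \<open>Deflation: subtracting the outer sum leaves a matrix \<open>D\<close> that kills every
  \<open>v i\<close> and whose transpose kills every \<open>u i\<close>. Hence any singular triple
  of \<open>D\<close> is orthogonal to the system; there the outer sum vanishes, so it is also a
  singular triple of \<open>M\<close>. The vector \<open>x\<close> shows that \<open>D\<close> is
  nonzero, so that such a triple exists.\<close>

lemma singular_system_extend:
  assumes M: "M \<in> carrier_mat m n" and sys: "singular_system M r s u v"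
    and x: "x \<in> carrier_vec n" "\<And>i. i < r \<Longrightarrow> v i \<bullet> x = 0" "M *\<^sub>v x \<noteq> 0\<^sub>v m"
  shows "\<exists>s u v. singular_system M (Suc r) s u v"
proof -
  have u: "orthonormal_family m r u" and v: "orthonormal_family n r v"
    and si: "\<And>i. i < r \<Longrightarrow> s i > 0" and Mv: "\<And>i. i < r \<Longrightarrow> M *\<^sub>v v i = s i \<cdot>\<^sub>v u i"
    and Mu: "\<And>i. i < r \<Longrightarrow> M\<^sup>T *\<^sub>v u i = s i \<cdot>\<^sub>v v i"
    using sys M unfolding singular_system_def by auto
  have uc: "\<And>i. i < r \<Longrightarrow> u i \<in> carrier_vec m" and vc: "\<And>i. i < r \<Longrightarrow> v i \<in> carrier_vec n"
    using u v by (auto simp: orthonormal_family_def)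
  define Q where "Q = outer_sum m n r s u v"
  define D where "D = M - Q"
  have Q: "Q \<in> carrier_mat m n" by (simp add: Q_def outer_sum_carrier)
  have D: "D \<in> carrier_mat m n" using M Q by (simp add: D_def minus_carrier_mat)
  have MT: "M\<^sup>T \<in> carrier_mat n m" and QT: "Q\<^sup>T \<in> carrier_mat n m"
    and DT: "D\<^sup>T \<in> carrier_mat n m" using M Q D by auto
  have DTe: "D\<^sup>T = M\<^sup>T - Q\<^sup>T" unfolding D_def by (rule transpose_minus[OF M Q])
  have QTe: "Q\<^sup>T = outer_sum n m r s v u" by (simp add: Q_def outer_sum_transpose)
  have Dmult: "D *\<^sub>v y = M *\<^sub>v y - Q *\<^sub>v y" if "y \<in> carrier_vec n" for y
    unfolding D_def by (rule minus_mult_distrib_mat_vec[OF M Q that])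
  have DTmult: "D\<^sup>T *\<^sub>v y = M\<^sup>T *\<^sub>v y - Q\<^sup>T *\<^sub>v y" if "y \<in> carrier_vec m" for y
    unfolding DTe by (rule minus_mult_distrib_mat_vec[OF MT QT that])
  have Dv: "D *\<^sub>v v i = 0\<^sub>v m" if "i < r" for i
    unfolding Dmult[OF vc[OF that]] Mv[OF that] Q_def
    using outer_sum_mult_member[of n r v u i m s, OF v uc[OF that] that] uc[OF that] by simp
  have Du: "D\<^sup>T *\<^sub>v u i = 0\<^sub>v n" if "i < r" for i
    unfolding DTmult[OF uc[OF that]] Mu[OF that] QTe
    using outer_sum_mult_member[of m r u v i n s, OF u vc[OF that] that] vc[OF that] by simp
  have "D *\<^sub>v x = M *\<^sub>v x"
    unfolding Dmult[OF x(1)] Q_def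
    using outer_sum_mult_orthogonal[of x n r v] x M by simp
  moreover have "0\<^sub>m m n *\<^sub>v x = 0\<^sub>v m" using x by (intro eq_vecI) auto
  ultimately have D0: "D \<noteq> 0\<^sub>m m n" using x(3) by auto
  obtain t p q where t: "t > 0" and p0: "p \<in> carrier_vec m" and q0: "q \<in> carrier_vec n"
    and p1: "p \<bullet> p = 1" and q1: "q \<bullet> q = 1"
    and Dq: "D *\<^sub>v q = t \<cdot>\<^sub>v p" and Dp: "D\<^sup>T *\<^sub>v p = t \<cdot>\<^sub>v q"
    using exists_singular_triple[OF D D0] .
  note p = p0 p1 and q = q0 q1
  have vq: "v i \<bullet> q = 0" if "i < r" for i
  proof -
    have "t * (v i \<bullet> q) = v i \<bullet> (D\<^sup>T *\<^sub>v p)" using Dp vc[OF that] q by simp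
    also have "\<dots> = (D *\<^sub>v v i) \<bullet> p"
      using scalar_prod_mult_mat_vec_transpose[OF D vc[OF that] p(1)] by simp
    also have "\<dots> = 0" using Dv[OF that] p by simp
    finally show ?thesis using t by simp
  qed
  have up: "u i \<bullet> p = 0" if "i < r" for i
  proof -
    have "t * (u i \<bullet> p) = u i \<bullet> (D *\<^sub>v q)" using Dq uc[OF that] p by simp
    also have "\<dots> = (D\<^sup>T *\<^sub>v u i) \<bullet> q"
      using scalar_prod_mult_mat_vec_transpose[OF DT uc[OF that] q(1)] by simp
    also have "\<dots> = 0" using Du[OF that] q by simp
    finally show ?thesis using t by simp
  qed
  have "M *\<^sub>v q = D *\<^sub>v q"
    unfolding Dmult[OF q(1)] Q_def
    using outer_sum_mult_orthogonal[of q n r v] q vq M by simp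
  moreover have "M\<^sup>T *\<^sub>v p = D\<^sup>T *\<^sub>v p"
    unfolding DTmult[OF p(1)] QTe
    using outer_sum_mult_orthogonal[of p m r u] p up MT by simp
  ultimately have "singular_system M (Suc r) (s(r := t)) (u(r := p)) (v(r := q))"
    unfolding singular_system_def
    using M orthonormal_family_Suc[OF u p up] orthonormal_family_Suc[OF v q vq] t Dq Dp si Mv Mu
    by (auto simp: less_Suc_eq)
  then show ?thesis by blast
qed

lemma exists_full_singular_system:
  fixes M :: "real mat"
  obtains r s u v where "full_singular_system M r s u v"
proof -
  define P where "P r \<longleftrightarrow> (\<exists>s u v. singular_system M r s u v)" for r
  have P0: "P 0" by (simp add: P_def singular_system_def orthonormal_family_def)
  have bound: "r \<le> dim_col M" if "P r" for r
    using that orthonormal_family_le unfolding P_def singular_system_def by blast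
  define g where "g = Greatest P"
  have "P g" unfolding g_def using GreatestI_nat[of P 0 "dim_col M"] P0 bound by auto
  then obtain s u v where sys: "singular_system M g s u v" unfolding P_def by blast
  have "\<not> P (Suc g)"
  proof
    assume "P (Suc g)"
    then have "Suc g \<le> g" unfolding g_def by (rule Greatest_le_nat) (use bound in auto)
    then show False by simp
  qed
  then have "M *\<^sub>v x = 0\<^sub>v (dim_row M)"
    if "x \<in> carrier_vec (dim_col M)" "\<forall>i<g. v i \<bullet> x = 0" for x
    using singular_system_extend[OF _ sys that(1), of "dim_row M"] that(2)
    unfolding P_def by auto
  then have "full_singular_system M g s u v"
    using sys by (simp add: full_singular_system_def)
  then show ?thesis by (rule that)
qed

lemma singular_systemD:
  assumes "M \<in> carrier_mat m n" "singular_system M r s u v"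
  shows "orthonormal_family m r u" "orthonormal_family n r v"
    "i < r \<Longrightarrow> u i \<in> carrier_vec m" "i < r \<Longrightarrow> v i \<in> carrier_vec n"
    "i < r \<Longrightarrow> s i > 0" "i < r \<Longrightarrow> M *\<^sub>v v i = s i \<cdot>\<^sub>v u i" "i < r \<Longrightarrow> M\<^sup>T *\<^sub>v u i = s i \<cdot>\<^sub>v v i"
  using assms unfolding singular_system_def orthonormal_family_def by auto

lemma singular_system_transpose:
  assumes "singular_system M r s u v"
  shows "singular_system M\<^sup>T r s v u"
  using assms by (auto simp: singular_system_def)

text \<open>If \<open>x\<close> is orthogonal to all \<open>u i\<close>, then
  \<open>M\<^sup>T *\<^sub>v x\<close> is orthogonal to all \<open>v i\<close> and hence killed by
  \<open>M\<close>; pairing with \<open>x\<close> shows that its norm is zero.\<close>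

lemma full_singular_system_transpose:
  assumes "full_singular_system M r s u v"
  shows "full_singular_system M\<^sup>T r s v u"
proof -
  define m n where "m = dim_row M" and "n = dim_col M"
  have M: "M \<in> carrier_mat m n" and MT: "M\<^sup>T \<in> carrier_mat n m" by (auto simp: m_def n_def)
  have sys: "singular_system M r s u v"
    and ker: "\<And>y. y \<in> carrier_vec n \<Longrightarrow> \<forall>i<r. v i \<bullet> y = 0 \<Longrightarrow> M *\<^sub>v y = 0\<^sub>v m"
    using assms unfolding full_singular_system_def m_def n_def by auto
  have "M\<^sup>T *\<^sub>v x = 0\<^sub>v n" if x: "x \<in> carrier_vec m" and ux: "\<forall>i<r. u i \<bullet> x = 0" for x
  proof -
    have y: "M\<^sup>T *\<^sub>v x \<in> carrier_vec n" using MT x by simp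
    have "v i \<bullet> (M\<^sup>T *\<^sub>v x) = 0" if "i < r" for i
      using scalar_prod_mult_mat_vec_transpose[OF M _ x] singular_systemD[OF M sys] that ux x
      by (metis carrier_vecD mult_zero_right scalar_prod_smult_left)
    then have "M *\<^sub>v (M\<^sup>T *\<^sub>v x) = 0\<^sub>v m" using ker[OF y] by simp
    then have "(M\<^sup>T *\<^sub>v x) \<bullet> (M\<^sup>T *\<^sub>v x) = 0"
      using scalar_prod_mult_mat_vec_transpose[OF MT x y] x by simp
    then show ?thesis using scalar_prod_self_eq_0_iff[OF y] by simp
  qed
  then show ?thesis
    using singular_system_transpose[OF sys]
    by (auto simp: full_singular_system_def m_def n_def)
qed

section \<open>Bases of the row and column spaces, and the rank\<close>

lemma orthonormal_family_distinct:
  assumes "orthonormal_family n r u"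
  shows "distinct (map u [0..<r])"
proof -
  have "u i \<noteq> u j" if "i < r" "j < r" "i \<noteq> j" for i j
  proof
    assume "u i = u j"
    moreover have "u i \<bullet> u i = 1" "u i \<bullet> u j = 0"
      using assms that unfolding orthonormal_family_def by auto
    ultimately show False by simp
  qed
  then have "inj_on u {..<r}" by (intro inj_onI) (metis lessThan_iff)
  then show ?thesis by (simp add: distinct_map atLeast0LessThan)
qed

lemma orthonormal_family_lin_indpt:
  assumes u: "orthonormal_family n r u"
  shows "LinearCombinations.module.lin_indpt class_ring (module_vec TYPE(real) n) (set (map u [0..<r]))"
proof -
  interpret vec_space "TYPE(real)" n .
  show ?thesis
  proof
    assume "lin_dep (set (map u [0..<r]))"
    then obtain x where "x \<in> carrier_vec r" "x \<noteq> 0\<^sub>v r" "family_mat n r u *\<^sub>v x = 0\<^sub>v n"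
      using lin_depE[OF family_mat_carrier(1)[of n r u]] orthonormal_family_distinct[OF u]
      unfolding cols_family_mat[OF u] by blast
    then show False using family_mat_mult_vec_inject[OF u] by blast
  qed
qed

lemma full_singular_system_row_basis:
  assumes M: "M \<in> carrier_mat m n" and full: "full_singular_system M r s u v"
  shows "is_basis_of n (map v [0..<r]) (Row M)"
proof -
  interpret vec_space "TYPE(real)" n .
  have sys: "singular_system M r s u v"
    and ker: "\<And>y. y \<in> carrier_vec n \<Longrightarrow> \<forall>i<r. v i \<bullet> y = 0 \<Longrightarrow> M *\<^sub>v y = 0\<^sub>v m"
    using full M unfolding full_singular_system_def by auto
  note sysD = singular_systemD[OF M sys]
  let ?W = "family_mat n r v"
  have MT: "M\<^sup>T \<in> carrier_mat n m" using M by simp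
  have W: "?W \<in> carrier_mat n r" "?W\<^sup>T \<in> carrier_mat r n" by auto
  have span_W: "span (set (map v [0..<r])) = {y \<in> carrier_vec n. \<exists>x\<in>carrier_vec r. ?W *\<^sub>v x = y}"
    using col_space_eq[OF W(1)] unfolding col_space_def cols_family_mat[OF sysD(2)] by simp
  have Row: "Row M = {w \<in> carrier_vec n. \<exists>y\<in>carrier_vec m. M\<^sup>T *\<^sub>v y = w}"
    using row_space_eq[OF M] M by auto
  have "span (set (map v [0..<r])) = Row M"
  proof
    have "v i \<in> Row M" if "i < r" for i
    proof -
      have "M\<^sup>T *\<^sub>v ((1 / s i) \<cdot>\<^sub>v u i) = v i"
        using mult_mat_vec[OF MT sysD(3)[OF that], of "1 / s i"] sysD(7)[OF that] sysD(5)[OF that]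
        by (simp add: smult_smult_assoc)
      then show ?thesis
        unfolding Row using sysD(3,4)[OF that] by (auto intro: bexI[of _ "(1 / s i) \<cdot>\<^sub>v u i"])
    qed
    then have "set (map v [0..<r]) \<subseteq> span (set (rows M))"
      using M by (auto simp: row_space_def)
    moreover have "set (rows M) \<subseteq> carrier_vec n" using M by (auto simp: rows_def)
    ultimately show "span (set (map v [0..<r])) \<subseteq> Row M"
      using span_subsetI M by (simp add: row_space_def)
    show "Row M \<subseteq> span (set (map v [0..<r]))"
    proof
      fix y assume "y \<in> Row M"
      then obtain z where y: "y \<in> carrier_vec n" and z: "z \<in> carrier_vec m" and yz: "y = M\<^sup>T *\<^sub>v z"
        unfolding Row by blast
      have Wy: "?W\<^sup>T *\<^sub>v y \<in> carrier_vec r" by (rule mult_mat_vec_carrier[OF W(2) y])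
      have WWy: "?W *\<^sub>v (?W\<^sup>T *\<^sub>v y) \<in> carrier_vec n" by (rule mult_mat_vec_carrier[OF W(1) Wy])
      \<comment> \<open>\<open>w\<close> is the residual of \<open>y\<close> after projection to the
        span of the \<open>v i\<close>. It is orthogonal to them, so fullness gives
        \<open>M *\<^sub>v w = 0\<^sub>v m\<close>, and \<open>w\<close> is orthogonal to
        \<open>y\<close>, which lies in the row space. Being orthogonal to \<open>y\<close> and to
        its projection, \<open>w\<close> is orthogonal to itself.\<close>
      define w where "w = y - ?W *\<^sub>v (?W\<^sup>T *\<^sub>v y)"
      have w: "w \<in> carrier_vec n" using y WWy by (simp add: w_def)
      have "?W\<^sup>T *\<^sub>v w = ?W\<^sup>T *\<^sub>v y - (?W\<^sup>T * ?W) *\<^sub>v (?W\<^sup>T *\<^sub>v y)"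
        unfolding w_def mult_minus_distrib_mat_vec[OF W(2) y WWy]
          assoc_mult_mat_vec[OF W(2,1) Wy] ..
      also have "\<dots> = 0\<^sub>v r"
        unfolding family_mat_transpose_mult[OF sysD(2)] using Wy by simp
      finally have Ww: "?W\<^sup>T *\<^sub>v w = 0\<^sub>v r" .
      then have "v i \<bullet> w = 0" if "i < r" for i
        using that arg_cong[OF Ww[unfolded family_mat_transpose_mult_vec[OF sysD(2) w]],
          of "\<lambda>x. x $ i"] by simp
      then have "M *\<^sub>v w = 0\<^sub>v m" using ker[OF w] by simp
      then have 1: "w \<bullet> y = 0"
        unfolding yz using scalar_prod_mult_mat_vec_transpose[OF M w z] z by simp
      have 2: "w \<bullet> (?W *\<^sub>v (?W\<^sup>T *\<^sub>v y)) = 0"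
        using scalar_prod_mult_mat_vec_transpose[OF W(2) w Wy] Ww Wy by simp
      have "w \<bullet> w = w \<bullet> (y - ?W *\<^sub>v (?W\<^sup>T *\<^sub>v y))" by (simp add: w_def)
      also have "\<dots> = 0"
        unfolding scalar_prod_minus_distrib[OF w y WWy] 1 2 by simp
      finally have "w = 0\<^sub>v n" using scalar_prod_self_eq_0_iff[OF w] by simp
      then have "y $ i = (?W *\<^sub>v (?W\<^sup>T *\<^sub>v y)) $ i" if "i < n" for i
        using that arg_cong[OF w_def, of "\<lambda>x. x $ i"] y WWy by simp
      then have "?W *\<^sub>v (?W\<^sup>T *\<^sub>v y) = y" using y by (intro eq_vecI) auto
      then show "y \<in> span (set (map v [0..<r]))" unfolding span_W using y Wy by blast
    qed
  qed
  then show ?thesis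
    unfolding is_basis_of_def
    using orthonormal_family_distinct[OF sysD(2)] orthonormal_family_lin_indpt[OF sysD(2)] sysD(4)
    by auto
qed

lemma full_singular_system_col_basis:
  assumes M: "M \<in> carrier_mat m n" and full: "full_singular_system M r s u v"
  shows "is_basis_of m (map u [0..<r]) (Col M)"
  using full_singular_system_row_basis[OF _ full_singular_system_transpose[OF full], of n m] M
  by (simp add: vec_space.col_space_eq_row_space_transpose)

text \<open>Identifies the number of positive singular values with the rank, which is the
  \<open>k\<close> of the theorem. The rank depends only on the span of the columns, so the matrix
  of the \<open>u i\<close> may replace \<open>M\<close>.\<close>

lemma full_singular_system_rank:
  assumes M: "M \<in> carrier_mat m n" and full: "full_singular_system M r s u v"
  shows "vec_space.rank m M = r"
proof -
  interpret vec_space "TYPE(real)" m .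
  have u: "orthonormal_family m r u"
    using full M unfolding full_singular_system_def singular_system_def by auto
  have "span (set (cols M)) = span (set (map u [0..<r]))"
    using full_singular_system_col_basis[OF M full] M unfolding is_basis_of_def
    by (auto simp: col_space_def)
  then have "rank M = rank (family_mat m r u)"
    unfolding rank_def cols_family_mat[OF u] by simp
  also have "\<dots> = r"
    using orthonormal_family_lin_indpt[OF u] orthonormal_family_distinct[OF u] cols_family_mat[OF u]
    by (intro lin_indpt_full_rank[OF family_mat_carrier(1)]) auto
  finally show ?thesis .
qed

text \<open>Singular systems are taken for \<open>-E/2\<close>, whereas the theorem speaks of the
  row and column spaces of \<open>E\<close>.\<close>

lemma Row_smult:
  fixes M :: "real mat"
  assumes "c \<noteq> 0"
  shows "Row (c \<cdot>\<^sub>m M) = Row M"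
proof -
  define m n where "m = dim_row M" and "n = dim_col M"
  have M: "M \<in> carrier_mat m n" "c \<cdot>\<^sub>m M \<in> carrier_mat m n" by (auto simp: m_def n_def)
  interpret vec_space "TYPE(real)" n .
  have eq: "(c \<cdot>\<^sub>m M)\<^sup>T *\<^sub>v y = M\<^sup>T *\<^sub>v (c \<cdot>\<^sub>v y)" if "y \<in> carrier_vec m" for y
    using that M by (intro eq_vecI) (auto simp: scalar_prod_def sum_distrib_left mult_ac)
  have "(c \<cdot>\<^sub>m M)\<^sup>T *\<^sub>v ((1/c) \<cdot>\<^sub>v y) = M\<^sup>T *\<^sub>v y" if "y \<in> carrier_vec m" for y
    using assms that by (simp add: eq smult_smult_assoc)
  then have "row_space (c \<cdot>\<^sub>m M) = row_space M"
    unfolding row_space_eq[OF M(1)] row_space_eq[OF M(2)] using M eq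
    by (auto; metis smult_carrier_vec)
  then show ?thesis by (simp add: n_def)
qed

lemma transpose_smult_mat: "(c \<cdot>\<^sub>m M)\<^sup>T = c \<cdot>\<^sub>m M\<^sup>T"
  by (intro eq_matI) auto

lemma Col_smult:
  fixes M :: "real mat"
  assumes "c \<noteq> 0"
  shows "Col (c \<cdot>\<^sub>m M) = Col M"
  using Row_smult[OF assms, of "M\<^sup>T"]
  by (simp add: vec_space.col_space_eq_row_space_transpose transpose_smult_mat)

lemma rank_eq_if_Col_eq:
  assumes "M \<in> carrier_mat m n" "N \<in> carrier_mat m n" "Col M = Col N"
  shows "vec_space.rank m M = vec_space.rank m N"
  using assms by (simp add: vec_space.rank_def vec_space.col_space_def)

section \<open>Singular value decompositions\<close>

lemma orthogonal_mult_transpose: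
  assumes "orthogonal_matrix_of n V"
  shows "V * V\<^sup>T = 1\<^sub>m n"
  using assms mat_mult_left_right_inverse[of "V\<^sup>T" n V] by (simp add: orthogonal_matrix_of_def)

text \<open>The inner factor \<open>V\<^sup>T * V\<close> cancels. With \<open>X = Y\<close> this
  diagonalizes \<open>M * M\<^sup>T\<close>; with different middle factors it transfers
  orthogonality from diagonal matrices to the matrices built from them.\<close>

lemma mult_transpose_two_sided:
  assumes U: "U \<in> carrier_mat m m" and V: "orthogonal_matrix_of n V"
    and X: "X \<in> carrier_mat m n" and Y: "Y \<in> carrier_mat m n"
  shows "(U * X * V\<^sup>T) * (U * Y * V\<^sup>T)\<^sup>T = U * (X * Y\<^sup>T) * U\<^sup>T"
proof -
  have c: "V \<in> carrier_mat n n" "V\<^sup>T \<in> carrier_mat n n" "U\<^sup>T \<in> carrier_mat m m"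
    "Y\<^sup>T \<in> carrier_mat n m" "U * X \<in> carrier_mat m n" "U * Y \<in> carrier_mat m n"
    "Y\<^sup>T * U\<^sup>T \<in> carrier_mat n m"
    using assms unfolding orthogonal_matrix_of_def by auto
  have VV: "V\<^sup>T * V = 1\<^sub>m n" using V by (simp add: orthogonal_matrix_of_def)
  have "(U * Y * V\<^sup>T)\<^sup>T = V * (Y\<^sup>T * U\<^sup>T)"
    using transpose_mult[OF c(6,2)] transpose_mult[OF U Y] by simp
  then have "(U * X * V\<^sup>T) * (U * Y * V\<^sup>T)\<^sup>T = U * X * (V\<^sup>T * (V * (Y\<^sup>T * U\<^sup>T)))"
    using assoc_mult_mat[OF c(5,2), of "V * (Y\<^sup>T * U\<^sup>T)" m] c by simp
  also have "V\<^sup>T * (V * (Y\<^sup>T * U\<^sup>T)) = Y\<^sup>T * U\<^sup>T"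
    using assoc_mult_mat[OF c(2,1,7)] VV c by simp
  also have "U * X * (Y\<^sup>T * U\<^sup>T) = U * (X * (Y\<^sup>T * U\<^sup>T))"
    using assoc_mult_mat[OF U X c(7)] .
  also have "X * (Y\<^sup>T * U\<^sup>T) = X * Y\<^sup>T * U\<^sup>T"
    using assoc_mult_mat[OF X c(4,3)] by simp
  also have "U * (X * Y\<^sup>T * U\<^sup>T) = U * (X * Y\<^sup>T) * U\<^sup>T"
    using assoc_mult_mat[OF U _ c(3), of "X * Y\<^sup>T"] X c by simp
  finally show ?thesis .
qed

lemma proots_prod_list_linear:
  fixes xs :: "real list"
  shows "proots (\<Prod>a\<leftarrow>xs. [:- a, 1:]) = mset xs"
proof (induction xs)
  case (Cons a xs)
  have "(\<Prod>a\<leftarrow>xs. [:- a, 1:]) \<noteq> 0" by (auto simp: prod_list_zero_iff)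
  then have "proots ([:- a, 1:] * (\<Prod>a\<leftarrow>xs. [:- a, 1:])) = {#a#} + mset xs"
    using Cons by (subst proots_mult) auto
  then show ?case by simp
qed simp

text \<open>The right-hand side mentions only \<open>M\<close>, so the multiset on the left does not
  depend on the chosen decomposition. Multiplicities are kept by working with root
  multisets.\<close>

lemma positive_diag_eq_char_poly_roots:
  assumes M: "M \<in> carrier_mat m n" and svd: "is_svd M U Sig V"
  shows "positive_diag Sig =
    image_mset sqrt (filter_mset (\<lambda>x. 0 < x) (proots (char_poly (M * M\<^sup>T))))"
proof -
  have U: "orthogonal_matrix_of m U" and V: "orthogonal_matrix_of n V"
    and Sig: "Sig \<in> carrier_mat m n"
    and off: "\<And>i j. i < m \<Longrightarrow> j < n \<Longrightarrow> i \<noteq> j \<Longrightarrow> Sig $$ (i,j) = 0"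
    and nonneg: "\<And>i. i < min m n \<Longrightarrow> Sig $$ (i,i) \<ge> 0"
    and MU: "M = U * Sig * V\<^sup>T"
    using svd M unfolding is_svd_def Let_def by auto
  have Uc: "U \<in> carrier_mat m m" "U\<^sup>T * U = 1\<^sub>m m" "U * U\<^sup>T = 1\<^sub>m m"
    using U orthogonal_mult_transpose[OF U] by (auto simp: orthogonal_matrix_of_def)
  \<comment> \<open>If \<open>m > n\<close>, the matrix \<open>Sig * Sig\<^sup>T\<close> has
    diagonal entries beyond those of \<open>Sig\<close>. They are zero, and the filter for positive
    roots removes them.\<close>
  define d where "d i = (if i < n then (Sig $$ (i,i))\<^sup>2 else 0)" for i
  define D where "D = Sig * Sig\<^sup>T"
  have D: "D \<in> carrier_mat m m" using Sig by (simp add: D_def)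
  have De: "D $$ (i,j) = (if i = j then d i else 0)" if ij: "i < m" "j < m" for i j
  proof -
    have "D $$ (i,j) = (\<Sum>b<n. Sig $$ (i,b) * Sig $$ (j,b))"
      using ij Sig by (simp add: D_def scalar_prod_def atLeast0LessThan)
    also have "\<dots> = (\<Sum>b<n. if b = i then Sig $$ (i,b) * Sig $$ (j,b) else 0)"
      using off ij by (intro sum.cong) auto
    also have "\<dots> = (if i < n then Sig $$ (i,i) * Sig $$ (j,i) else 0)" by simp
    also have "\<dots> = (if i = j then d i else 0)"
      using off ij by (auto simp: d_def power2_eq_square)
    finally show ?thesis .
  qed
  have "M * M\<^sup>T = U * D * U\<^sup>T"
    unfolding MU D_def by (rule mult_transpose_two_sided[OF Uc(1) V Sig Sig])
  then have "similar_mat (M * M\<^sup>T) D"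
    using Uc D M by (intro similar_matI[of _ _ U "U\<^sup>T" m]) auto
  then have "char_poly (M * M\<^sup>T) = char_poly D" by (rule char_poly_similar)
  also have "\<dots> = (\<Prod>a\<leftarrow>diag_mat D. [:- a, 1:])"
    by (rule char_poly_upper_triangular[OF D]) (use D De in \<open>auto simp: upper_triangular_def\<close>)
  also have "diag_mat D = map d [0..<m]"
    using D De by (auto simp: diag_mat_def)
  finally have "proots (char_poly (M * M\<^sup>T)) = image_mset d (mset_set {0..<m})"
    using proots_prod_list_linear[of "map d [0..<m]"] by simp
  then have "filter_mset (\<lambda>x. 0 < x) (proots (char_poly (M * M\<^sup>T))) =
      image_mset d (mset_set {i\<in>{0..<m}. 0 < d i})"
    by (simp add: filter_mset_image_mset filter_mset_mset_set)
  also have "{i\<in>{0..<m}. 0 < d i} = {i. i < min m n \<and> 0 < Sig $$ (i,i)}"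
    using nonneg by (force simp: d_def less_le)
  also have "image_mset sqrt (image_mset d (mset_set {i. i < min m n \<and> 0 < Sig $$ (i,i)})) =
      positive_diag Sig"
    unfolding positive_diag_def multiset.map_comp carrier_matD[OF Sig]
    by (intro image_mset_cong) (auto simp: d_def)
  finally show ?thesis by simp
qed

lemma positive_diag_unique:
  assumes "is_svd M U Sig V" "is_svd M U' Sig' V'"
  shows "positive_diag Sig = positive_diag Sig'"
  using positive_diag_eq_char_poly_roots[of M "dim_row M" "dim_col M"] assms by auto

section \<open>From orthogonal summands to a sign change\<close>

lemma diagonal_decomposition:
  fixes M :: "real mat"
  assumes M: "M \<in> carrier_mat m n" and w: "orthonormal_family m m w" and z: "orthonormal_family n n z"
    and D: "D \<in> carrier_mat m n" and off: "\<And>i j. i < m \<Longrightarrow> j < n \<Longrightarrow> i \<noteq> j \<Longrightarrow> D $$ (i,j) = 0"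
    and Mz: "\<And>j. j < n \<Longrightarrow> M *\<^sub>v z j = (if j < m then D $$ (j,j) \<cdot>\<^sub>v w j else 0\<^sub>v m)"
  shows "M = family_mat m m w * D * (family_mat n n z)\<^sup>T"
proof -
  let ?U = "family_mat m m w" and ?V = "family_mat n n z"
  have U: "?U \<in> carrier_mat m m" and V: "?V \<in> carrier_mat n n" "?V\<^sup>T \<in> carrier_mat n n" by auto
  \<comment> \<open>Compared column by column. For \<open>j\<close> at least \<open>m\<close>,
    column \<open>j\<close> of \<open>D\<close> lies beyond the diagonal and is zero, which is why
    \<open>M\<close> is required to kill \<open>z j\<close> there. Negative diagonal entries are
    allowed, so that the flipped matrix is covered too.\<close>
  have "M * ?V = ?U * D"
  proof (rule eq_matI)
    fix a j assume "a < dim_row (?U * D)" "j < dim_col (?U * D)"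
    then have a: "a < m" and j: "j < n" using D by auto
    have wc: "w b $ a = ?U $$ (a,b)" if "b < m" for b
      using a that col_family_mat[OF w that] by (metis U carrier_matD index_col)
    have "(M * ?V) $$ (a,j) = (M *\<^sub>v z j) $ a"
      using a j M col_family_mat[OF z j] by simp
    also have "\<dots> = (if j < m then D $$ (j,j) * w j $ a else 0)"
      using Mz[OF j] a w by (auto simp: orthonormal_family_def)
    also have "\<dots> = (\<Sum>b<m. if b = j then ?U $$ (a,b) * D $$ (b,j) else 0)"
      using wc by simp
    also have "\<dots> = (\<Sum>b<m. ?U $$ (a,b) * D $$ (b,j))"
      using off j by (intro sum.cong) auto
    also have "\<dots> = (?U * D) $$ (a,j)"
      using a j D by (simp add: scalar_prod_def atLeast0LessThan)
    finally show "(M * ?V) $$ (a,j) = (?U * D) $$ (a,j)" .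
  qed (use M D in auto)
  moreover have "M = M * ?V * ?V\<^sup>T"
    using assoc_mult_mat[OF M V] orthogonal_mult_transpose[OF orthogonal_family_mat[OF z]] M by simp
  ultimately show ?thesis by simp
qed

text \<open>Since \<open>s i\<close> is positive, \<open>v i\<close> is a multiple of
  \<open>M\<^sup>T *\<^sub>v u i\<close>, on which \<open>N\<close> vanishes.\<close>

lemma mult_singular_vec_eq_0:
  fixes M N :: "real mat"
  assumes M: "M \<in> carrier_mat m n" and N: "N \<in> carrier_mat l n" and NM: "N * M\<^sup>T = 0\<^sub>m l m"
    and sys: "singular_system M r s u v" and i: "i < r"
  shows "N *\<^sub>v v i = 0\<^sub>v l"
proof -
  note D = singular_systemD[OF M sys]
  have "M\<^sup>T \<in> carrier_mat n m" using M by simp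
  from assoc_mult_mat_vec[OF N this D(3)[OF i]]
  have "N *\<^sub>v (M\<^sup>T *\<^sub>v u i) = 0\<^sub>m l m *\<^sub>v u i" using NM by simp
  then have "s i \<cdot>\<^sub>v (N *\<^sub>v v i) = 0\<^sub>v l"
    using D(3,7)[OF i] mult_mat_vec[OF N D(4)[OF i]] by auto
  then have "s i * (N *\<^sub>v v i) $ a = 0" if "a < l" for a
    using that N by (metis carrier_matD(1) dim_mult_mat_vec index_smult_vec(1) index_zero_vec(1))
  then show ?thesis using D(5)[OF i] N by (intro eq_vecI) auto
qed

lemma orthonormal_family_append:
  assumes u: "orthonormal_family n r u" and p: "orthonormal_family n l p"
    and 0: "\<And>i j. i < r \<Longrightarrow> j < l \<Longrightarrow> u i \<bullet> p j = 0"
  shows "orthonormal_family n (r + l) (\<lambda>i. if i < r then u i else p (i - r))"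
proof -
  have "p j \<bullet> u i = 0" if "i < r" "j < l" for i j
    using 0[OF that] that u p comm_scalar_prod[of "p j" n "u i"]
    by (auto simp: orthonormal_family_def)
  then show ?thesis
    using u p 0 unfolding orthonormal_family_def by auto
qed

text \<open>The singular systems of \<open>F\<close> and \<open>C\<close> are orthogonal to each other, so they concatenate to a
  singular system of \<open>F + C\<close>; passing from \<open>F + C\<close> to \<open>C - F\<close> flips the signs of the part from \<open>F\<close>.\<close>

lemma sign_change_of_orthogonal_sum:
  fixes F C :: "real mat"
  assumes F: "F \<in> carrier_mat m n" and C: "C \<in> carrier_mat m n"
    and CF: "C * F\<^sup>T = 0\<^sub>m m m" and FC: "F\<^sup>T * C = 0\<^sub>m n n"
    and fullF: "full_singular_system F k s u v"
  shows "obtained_by_sign_change (F + C) (C - F) k"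
proof -
  obtain l t p q where fullC: "full_singular_system C l t p q" using exists_full_singular_system .
  have T: "F\<^sup>T \<in> carrier_mat n m" "C\<^sup>T \<in> carrier_mat n m" using F C by auto
  have FCT: "F * C\<^sup>T = 0\<^sub>m m m" and CTF: "C\<^sup>T * F = 0\<^sub>m n n"
    using arg_cong[OF CF, of transpose_mat] arg_cong[OF FC, of transpose_mat]
      transpose_mult[OF C T(1)] transpose_mult[OF T(1) C] by auto
  have sysF: "singular_system F k s u v" and sysC: "singular_system C l t p q"
    and kerF: "\<And>y. y \<in> carrier_vec n \<Longrightarrow> \<forall>i<k. v i \<bullet> y = 0 \<Longrightarrow> F *\<^sub>v y = 0\<^sub>v m"
    and kerC: "\<And>y. y \<in> carrier_vec n \<Longrightarrow> \<forall>i<l. q i \<bullet> y = 0 \<Longrightarrow> C *\<^sub>v y = 0\<^sub>v m"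
    using fullF fullC F C unfolding full_singular_system_def by auto
  note DF = singular_systemD[OF F sysF] and DC = singular_systemD[OF C sysC]
  have Cv: "C *\<^sub>v v i = 0\<^sub>v m" if "i < k" for i
    by (rule mult_singular_vec_eq_0[OF F C CF sysF that])
  have Fq: "F *\<^sub>v q j = 0\<^sub>v m" if "j < l" for j
    by (rule mult_singular_vec_eq_0[OF C F FCT sysC that])
  have Fp: "F\<^sup>T *\<^sub>v p j = 0\<^sub>v n" if "j < l" for j
    by (rule mult_singular_vec_eq_0[OF T(2,1) _ singular_system_transpose[OF sysC] that])
      (simp add: FC)
  have vq: "v i \<bullet> q j = 0" if "i < k" "j < l" for i j
  proof -
    have "s i * (v i \<bullet> q j) = (F\<^sup>T *\<^sub>v u i) \<bullet> q j"
      using smult_scalar_prod_distrib[OF DF(4)[OF that(1)] DC(4)[OF that(2)]] DF(7)[OF that(1)] by simp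
    also have "\<dots> = u i \<bullet> (F *\<^sub>v q j)"
      by (rule transpose_vec_mult_scalar[OF F DC(4)[OF that(2)] DF(3)[OF that(1)]])
    also have "\<dots> = 0" using Fq[OF that(2)] DF(3)[OF that(1)] by simp
    finally show ?thesis using DF(5)[OF that(1)] by simp
  qed
  have up: "u i \<bullet> p j = 0" if "i < k" "j < l" for i j
  proof -
    have "s i * (u i \<bullet> p j) = (F *\<^sub>v v i) \<bullet> p j"
      using smult_scalar_prod_distrib[OF DF(3)[OF that(1)] DC(3)[OF that(2)]] DF(6)[OF that(1)] by simp
    also have "\<dots> = v i \<bullet> (F\<^sup>T *\<^sub>v p j)"
      by (rule scalar_prod_mult_mat_vec_transpose[OF F DF(4)[OF that(1)] DC(3)[OF that(2)]])
    also have "\<dots> = 0" using Fp[OF that(2)] DF(4)[OF that(1)] by simp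
    finally show ?thesis using DF(5)[OF that(1)] by simp
  qed
  \<comment> \<open>The two systems occupy the first \<open>r\<close> positions, \<open>F\<close>
    before \<open>C\<close>, and both sides are then completed to orthonormal bases. Beyond
    \<open>r\<close> the diagonal \<open>g\<close> is zero, and \<open>S\<close> negates exactly the
    first \<open>k\<close> positions.\<close>
  define r where "r = k + l"
  obtain w where w: "orthonormal_family m m w"
    and wi: "\<And>i. i < r \<Longrightarrow> w i = (if i < k then u i else p (i - k))"
    using orthonormal_family_extend[OF orthonormal_family_append[OF DF(1) DC(1) up]]
    unfolding r_def by blast
  obtain z where z: "orthonormal_family n n z"
    and zi: "\<And>i. i < r \<Longrightarrow> z i = (if i < k then v i else q (i - k))"
    using orthonormal_family_extend[OF orthonormal_family_append[OF DF(2) DC(2) vq]]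
    unfolding r_def by blast
  have rm: "r \<le> m" and rn: "r \<le> n"
    using orthonormal_family_le[OF orthonormal_family_append[OF DF(1) DC(1) up]]
      orthonormal_family_le[OF orthonormal_family_append[OF DF(2) DC(2) vq]]
    by (auto simp: r_def)
  have zc: "z j \<in> carrier_vec n" if "j < n" for j using z that by (simp add: orthonormal_family_def)
  define g where "g i = (if i < k then s i else if i < r then t (i - k) else 0)" for i
  define Sig where "Sig = mat m n (\<lambda>(i,j). if i = j then g i else 0)"
  define S where "S = mat m m (\<lambda>(i,j). if i = j then if i < k then - 1 else (1::real) else 0)"
  have Sig: "Sig \<in> carrier_mat m n" and S: "S \<in> carrier_mat m m" by (auto simp: Sig_def S_def)
  have gpos: "g i > 0" if "i < r" for i
    using that DF(5) DC(5) by (auto simp: g_def r_def)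
  have SSig: "(S * Sig) $$ (i,j) = (if i = j then if i < k then - g i else g i else 0)"
    if ij: "i < m" "j < n" for i j
  proof -
    have "(S * Sig) $$ (i,j) = (\<Sum>b<m. S $$ (i,b) * Sig $$ (b,j))"
      using ij Sig S by (simp add: scalar_prod_def atLeast0LessThan)
    also have "\<dots> = (\<Sum>b<m. if b = i then S $$ (i,b) * Sig $$ (b,j) else 0)"
      using ij by (intro sum.cong) (auto simp: S_def)
    also have "\<dots> = S $$ (i,i) * Sig $$ (i,j)" using ij by simp
    finally show ?thesis using ij by (auto simp: S_def Sig_def)
  qed
  have Fz: "F *\<^sub>v z j = (if j < k then g j \<cdot>\<^sub>v w j else 0\<^sub>v m)"
    and Cz: "C *\<^sub>v z j = (if k \<le> j \<and> j < r then g j \<cdot>\<^sub>v w j else 0\<^sub>v m)" if j: "j < n" for j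
  proof -
    consider "j < k" | "k \<le> j" "j < r" | "r \<le> j" by linarith
    then have "F *\<^sub>v z j = (if j < k then g j \<cdot>\<^sub>v w j else 0\<^sub>v m) \<and>
      C *\<^sub>v z j = (if k \<le> j \<and> j < r then g j \<cdot>\<^sub>v w j else 0\<^sub>v m)"
    proof cases
      \<comment> \<open>A basis vector beyond \<open>r\<close> is orthogonal to the right vectors of
        both systems, so fullness makes both \<open>F\<close> and \<open>C\<close> vanish on
        it.\<close>
      case 3
      have orth: "z i \<bullet> z j = 0" if "i < r" for i
        using z j that 3 rn by (auto simp: orthonormal_family_def)
      have "v i \<bullet> z j = 0" if "i < k" for i
        using orth[of i] zi[of i] that by (simp add: r_def)
      moreover have "q i \<bullet> z j = 0" if "i < l" for i
        using orth[of "i + k"] zi[of "i + k"] that by (simp add: r_def)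
      ultimately show ?thesis using 3 kerF kerC zc[OF j] by (simp add: r_def)
    qed (use Cv Fq zi wi DF(6) DC(6) in \<open>auto simp: g_def r_def\<close>)
    then show "F *\<^sub>v z j = (if j < k then g j \<cdot>\<^sub>v w j else 0\<^sub>v m)"
      "C *\<^sub>v z j = (if k \<le> j \<and> j < r then g j \<cdot>\<^sub>v w j else 0\<^sub>v m)" by auto
  qed
  have wc: "w j \<in> carrier_vec m" if "j < m" for j using w that by (simp add: orthonormal_family_def)
  have "F + C = family_mat m m w * Sig * (family_mat n n z)\<^sup>T"
  proof (rule diagonal_decomposition[OF _ w z Sig])
    show "(F + C) *\<^sub>v z j = (if j < m then Sig $$ (j,j) \<cdot>\<^sub>v w j else 0\<^sub>v m)" if j: "j < n" for j
      unfolding add_mult_distrib_mat_vec[OF F C zc[OF j]] Fz[OF j] Cz[OF j]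
      using wc[of j] j rm by (auto simp: Sig_def g_def r_def intro!: eq_vecI)
  qed (use F C in \<open>auto simp: Sig_def\<close>)
  moreover have "C - F = family_mat m m w * (S * Sig) * (family_mat n n z)\<^sup>T"
  proof (rule diagonal_decomposition[OF _ w z])
    show "(C - F) *\<^sub>v z j = (if j < m then (S * Sig) $$ (j,j) \<cdot>\<^sub>v w j else 0\<^sub>v m)" if j: "j < n" for j
      unfolding minus_mult_distrib_mat_vec[OF C F zc[OF j]] Fz[OF j] Cz[OF j]
      using wc[of j] j rm SSig[of j j] by (auto simp: g_def r_def intro!: eq_vecI)
  qed (use F C S Sig SSig in \<open>auto simp: minus_carrier_mat\<close>)
  then have "C - F = family_mat m m w * S * Sig * (family_mat n n z)\<^sup>T"
    using assoc_mult_mat[OF family_mat_carrier(1) S Sig] by simp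
  moreover have "sign_flip_mat k m Sig S"
  proof -
    have "{i. i < m \<and> S $$ (i,i) = - 1} = {..<k}" using rm by (auto simp: S_def r_def split: if_splits)
    then show ?thesis
      unfolding sign_flip_mat_def using S Sig rn rm gpos
      by (auto simp: S_def Sig_def r_def split: if_splits)
  qed
  moreover have "0 \<le> g i" for i using gpos[of i] by (cases "i < r") (auto simp: g_def r_def)
  ultimately have "sign_change_witness (F + C) (C - F) k
      (family_mat m m w) Sig (family_mat n n z) S"
    unfolding sign_change_witness_def is_svd_def Let_def
    using F C Sig orthogonal_family_mat[OF w] orthogonal_family_mat[OF z] by (auto simp: Sig_def)
  then show ?thesis unfolding obtained_by_sign_change_def by blast
qed

section \<open>Gram mates\<close>

lemma double_add_mult_transpose_index:
  fixes A E :: "real mat"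
  assumes "A \<in> carrier_mat m n" "E \<in> carrier_mat m n" "i < m" "j < m"
  shows "((2 \<cdot>\<^sub>m A + E) * E\<^sup>T) $$ (i,j) = 2 * (row A i \<bullet> row E j) + row E i \<bullet> row E j"
  using assms by (simp add: add_scalar_prod_distrib[of _ n])

text \<open>Write \<open>a(i,j)\<close> for \<open>row A i \<bullet> row E j\<close> and
  \<open>e(i,j)\<close> for \<open>row E i \<bullet> row E j\<close>. Equality of the Gram matrices
  reads \<open>a(i,j) + a(j,i) + e(i,j) = 0\<close>, and orthogonality reads
  \<open>2 * a(i,j) + e(i,j) = 0\<close>. What follows compares these linear equations, using that
  \<open>e\<close> is symmetric.\<close>

lemma gram_add_index:
  fixes A E :: "real mat"
  assumes "A \<in> carrier_mat m n" "E \<in> carrier_mat m n" "i < m" "j < m"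
  shows "((A + E) * (A + E)\<^sup>T) $$ (i,j) = (A * A\<^sup>T) $$ (i,j) +
    (row A i \<bullet> row E j + row A j \<bullet> row E i + row E i \<bullet> row E j)"
proof -
  have "row E i \<bullet> row A j = row A j \<bullet> row E i"
    using assms by (intro comm_scalar_prod[of _ n]) auto
  then show ?thesis
    using assms by (simp add: add_scalar_prod_distrib[of _ n] scalar_prod_add_distrib[of _ n])
qed

lemma gram_add_eq_iff:
  fixes A E :: "real mat"
  assumes "A \<in> carrier_mat m n" "E \<in> carrier_mat m n"
  shows "A * A\<^sup>T = (A + E) * (A + E)\<^sup>T \<longleftrightarrow>
    (\<forall>i<m. \<forall>j<m. row A i \<bullet> row E j + row A j \<bullet> row E i + row E i \<bullet> row E j = 0)" (is "?l \<longleftrightarrow> ?r")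
proof
  assume ?l
  then show ?r using gram_add_index[OF assms] by simp
next
  assume ?r
  then have "(A * A\<^sup>T) $$ (i,j) = ((A + E) * (A + E)\<^sup>T) $$ (i,j)" if "i < m" "j < m" for i j
    using gram_add_index[OF assms that] that by simp
  then show ?l using assms by (intro eq_matI) auto
qed

lemma double_add_mult_transpose_eq_0_iff:
  fixes A E :: "real mat"
  assumes "A \<in> carrier_mat m n" "E \<in> carrier_mat m n"
  shows "(2 \<cdot>\<^sub>m A + E) * E\<^sup>T = 0\<^sub>m m m \<longleftrightarrow>
    (\<forall>i<m. \<forall>j<m. 2 * (row A i \<bullet> row E j) + row E i \<bullet> row E j = 0)" (is "?l \<longleftrightarrow> ?r")
proof
  assume ?l
  then show ?r using double_add_mult_transpose_index[OF assms] by (metis index_zero_mat(1))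
next
  assume ?r
  then have "((2 \<cdot>\<^sub>m A + E) * E\<^sup>T) $$ (i,j) = 0" if "i < m" "j < m" for i j
    using double_add_mult_transpose_index[OF assms that] that by simp
  then show ?l using assms by (intro eq_matI) auto
qed

lemma row_scalar_prod_comm:
  fixes E :: "real mat"
  assumes "E \<in> carrier_mat m n" "i < m" "j < m"
  shows "row E i \<bullet> row E j = row E j \<bullet> row E i"
  using assms by (intro comm_scalar_prod[of _ n]) auto

text \<open>The Gram equation at \<open>(i,j)\<close> is half the sum of the orthogonality equations
  at \<open>(i,j)\<close> and \<open>(j,i)\<close>.\<close>

lemma gram_eq_if_orthogonal:
  fixes A E :: "real mat"
  assumes A: "A \<in> carrier_mat m n" and E: "E \<in> carrier_mat m n"
    and 0: "(2 \<cdot>\<^sub>m A + E) * E\<^sup>T = 0\<^sub>m m m"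
  shows "A * A\<^sup>T = (A + E) * (A + E)\<^sup>T"
  unfolding gram_add_eq_iff[OF A E]
proof (intro allI impI)
  fix i j assume "i < m" "j < m"
  then have "2 * (row A i \<bullet> row E j) + row E i \<bullet> row E j = 0"
    "2 * (row A j \<bullet> row E i) + row E i \<bullet> row E j = 0"
    using 0 row_scalar_prod_comm[OF E] unfolding double_add_mult_transpose_eq_0_iff[OF A E] by auto
  then show "row A i \<bullet> row E j + row A j \<bullet> row E i + row E i \<bullet> row E j = 0" by linarith
qed

text \<open>The orthogonality and Gram equations at \<open>(i,j)\<close> differ by
  \<open>row A i \<bullet> row E j - row A j \<bullet> row E i\<close>, the defect of symmetry of
  \<open>A * E\<^sup>T\<close>.\<close>

lemma orthogonal_iff_symmetric:
  fixes A E :: "real mat"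
  assumes A: "A \<in> carrier_mat m n" and E: "E \<in> carrier_mat m n"
    and gram: "A * A\<^sup>T = (A + E) * (A + E)\<^sup>T"
  shows "(2 \<cdot>\<^sub>m A + E) * E\<^sup>T = 0\<^sub>m m m \<longleftrightarrow> A * E\<^sup>T = (A * E\<^sup>T)\<^sup>T"
proof -
  have "A * E\<^sup>T = (A * E\<^sup>T)\<^sup>T \<longleftrightarrow> (\<forall>i<m. \<forall>j<m. row A i \<bullet> row E j = row A j \<bullet> row E i)"
    (is "?l \<longleftrightarrow> ?r")
  proof
    assume ?l
    then have eq: "(A * E\<^sup>T) $$ (i,j) = (A * E\<^sup>T)\<^sup>T $$ (i,j)" for i j by simp
    show ?r
    proof (intro allI impI)
      fix i j assume "i < m" "j < m"
      then show "row A i \<bullet> row E j = row A j \<bullet> row E i" using eq[of i j] A E by simp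
    qed
  next
    assume ?r
    then show ?l using A E by (intro eq_matI) auto
  qed
  also have "\<dots> \<longleftrightarrow> (2 \<cdot>\<^sub>m A + E) * E\<^sup>T = 0\<^sub>m m m"
    unfolding double_add_mult_transpose_eq_0_iff[OF A E]
  proof (intro iffI allI impI)
    fix i j assume ij: "i < m" "j < m"
    note g = gram[unfolded gram_add_eq_iff[OF A E], rule_format, OF ij]
    {
      assume "\<forall>i<m. \<forall>j<m. row A i \<bullet> row E j = row A j \<bullet> row E i"
      then have "row A i \<bullet> row E j = row A j \<bullet> row E i" using ij by blast
      then show "2 * (row A i \<bullet> row E j) + row E i \<bullet> row E j = 0" using g by linarith
    next
      assume "\<forall>i<m. \<forall>j<m. 2 * (row A i \<bullet> row E j) + row E i \<bullet> row E j = 0"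
      then have "2 * (row A i \<bullet> row E j) + row E i \<bullet> row E j = 0" using ij by blast
      then show "row A i \<bullet> row E j = row A j \<bullet> row E i" using g by linarith
    }
  qed
  finally show ?thesis by simp
qed

text \<open>Turns condition (ii) for \<open>A\<close> and \<open>E\<close> into condition (i) for
  the transposes, so that facts about rows also serve for columns.\<close>

lemma transpose_orthogonal_iff:
  fixes A E :: "real mat"
  assumes A: "A \<in> carrier_mat m n" and E: "E \<in> carrier_mat m n"
  shows "E\<^sup>T * (2 \<cdot>\<^sub>m A + E) = 0\<^sub>m n n \<longleftrightarrow> (2 \<cdot>\<^sub>m A\<^sup>T + E\<^sup>T) * (E\<^sup>T)\<^sup>T = 0\<^sub>m n n"
proof -
  have D: "2 \<cdot>\<^sub>m A + E \<in> carrier_mat m n" and ET: "E\<^sup>T \<in> carrier_mat n m" using A E by auto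
  have "(E\<^sup>T * (2 \<cdot>\<^sub>m A + E))\<^sup>T = (2 \<cdot>\<^sub>m A\<^sup>T + E\<^sup>T) * (E\<^sup>T)\<^sup>T"
    using transpose_mult[OF ET D] transpose_add[of "2 \<cdot>\<^sub>m A" m n E] A E
    by (simp add: transpose_smult_mat)
  then show ?thesis by (metis transpose_transpose zero_transpose_mat)
qed

text \<open>The matrix \<open>L = (2A + E)\<^sup>T E\<close> is skew-symmetric by the Gram equation and satisfies \<open>L\<^sup>2 = 0\<close> by
  the orthogonality assumption, so \<open>L L\<^sup>T = 0\<close>.\<close>

lemma orthogonal_imp_transpose_orthogonal:
  fixes A E :: "real mat"
  assumes A: "A \<in> carrier_mat m n" and E: "E \<in> carrier_mat m n"
    and gram: "A\<^sup>T * A = (A + E)\<^sup>T * (A + E)"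
    and 0: "(2 \<cdot>\<^sub>m A + E) * E\<^sup>T = 0\<^sub>m m m"
  shows "E\<^sup>T * (2 \<cdot>\<^sub>m A + E) = 0\<^sub>m n n"
proof -
  define D where "D = 2 \<cdot>\<^sub>m A + E"
  define L where "L = D\<^sup>T * E"
  have D: "D \<in> carrier_mat m n" "D\<^sup>T \<in> carrier_mat n m" and ET: "E\<^sup>T \<in> carrier_mat n m"
    and AT: "A\<^sup>T \<in> carrier_mat n m" using A E by (auto simp: D_def)
  have L: "L \<in> carrier_mat n n" "L\<^sup>T \<in> carrier_mat n n" using D E by (auto simp: L_def)
  have DT: "D\<^sup>T = 2 \<cdot>\<^sub>m A\<^sup>T + E\<^sup>T"
    unfolding D_def using transpose_add[of "2 \<cdot>\<^sub>m A" m n E] A E by (simp add: transpose_smult_mat)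
  have LT: "L\<^sup>T = E\<^sup>T * D" using transpose_mult[OF D(2) E] by (simp add: L_def)
  have "A\<^sup>T * (A\<^sup>T)\<^sup>T = (A\<^sup>T + E\<^sup>T) * (A\<^sup>T + E\<^sup>T)\<^sup>T"
    using gram transpose_add[OF A E] by (metis transpose_transpose)
  note g = this[unfolded gram_add_eq_iff[OF AT ET], rule_format]
  have ent: "L $$ (i,j) = 2 * (row A\<^sup>T i \<bullet> row E\<^sup>T j) + row E\<^sup>T i \<bullet> row E\<^sup>T j" if "i < n" "j < n" for i j
    using double_add_mult_transpose_index[OF AT ET that] unfolding L_def DT by simp
  \<comment> \<open>The sum of the entries of \<open>L\<close> at \<open>(i,j)\<close> and
    \<open>(j,i)\<close> is twice the left-hand side of the Gram equation for the
    transposes.\<close>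
  have "L $$ (j,i) = - L $$ (i,j)" if "i < n" "j < n" for i j
    using g[OF that] ent[OF that] ent[OF that(2,1)] row_scalar_prod_comm[OF ET that] by linarith
  then have "L $$ (i,j) = (- L\<^sup>T) $$ (i,j)" if "i < n" "j < n" for i j
    using that L by (metis carrier_matD index_transpose_mat index_uminus_mat(1))
  then have skew: "L = - L\<^sup>T" by (rule eq_matI) (use L in auto)
  have "L\<^sup>T * L\<^sup>T = E\<^sup>T * (D * (E\<^sup>T * D))"
    unfolding LT using assoc_mult_mat[OF ET D(1), of "E\<^sup>T * D" n] ET D by simp
  also have "D * (E\<^sup>T * D) = 0\<^sub>m m n"
    using assoc_mult_mat[OF D(1) ET D(1)] 0[folded D_def] D by simp
  also have "E\<^sup>T * 0\<^sub>m m n = 0\<^sub>m n n" using ET by simp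
  finally have "L\<^sup>T * L\<^sup>T = 0\<^sub>m n n" .
  moreover have "L * L\<^sup>T = - (L\<^sup>T * L\<^sup>T)"
    using arg_cong[OF skew, of "\<lambda>X. X * L\<^sup>T"] uminus_mult_left_mat[of "L\<^sup>T" "L\<^sup>T"] L
    by (simp only: carrier_matD)
  ultimately have "L * L\<^sup>T = 0\<^sub>m n n" by auto
  then have "L = 0\<^sub>m n n" by (rule mult_transpose_self_eq_0[OF L(1)])
  then show ?thesis using LT by (simp add: D_def)
qed

lemma gram_mates_transpose:
  assumes A: "A \<in> carrier_mat m n" and E: "E \<in> carrier_mat m n"
  shows "gram_mates A\<^sup>T (A\<^sup>T + E\<^sup>T) \<longleftrightarrow> gram_mates A (A + E)"
proof -
  have "zero_one_mat M\<^sup>T \<longleftrightarrow> zero_one_mat M" for M by (auto simp: zero_one_mat_def)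
  then show ?thesis
    unfolding transpose_add[OF A E, symmetric] gram_mates_def
    by (auto dest: arg_cong[of _ _ transpose_mat])
qed

lemma gram_mates_orthogonal_iff:
  assumes A: "A \<in> carrier_mat m n" and E: "E \<in> carrier_mat m n" and gm: "gram_mates A (A + E)"
  shows "(2 \<cdot>\<^sub>m A + E) * E\<^sup>T = 0\<^sub>m m m \<longleftrightarrow> E\<^sup>T * (2 \<cdot>\<^sub>m A + E) = 0\<^sub>m n n"
proof
  show "(2 \<cdot>\<^sub>m A + E) * E\<^sup>T = 0\<^sub>m m m \<Longrightarrow> E\<^sup>T * (2 \<cdot>\<^sub>m A + E) = 0\<^sub>m n n"
    using orthogonal_imp_transpose_orthogonal[OF A E] gm by (simp add: gram_mates_def)
next
  have T: "A\<^sup>T \<in> carrier_mat n m" "E\<^sup>T \<in> carrier_mat n m" using A E by auto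
  assume "E\<^sup>T * (2 \<cdot>\<^sub>m A + E) = 0\<^sub>m n n"
  then have "(2 \<cdot>\<^sub>m A\<^sup>T + E\<^sup>T) * (E\<^sup>T)\<^sup>T = 0\<^sub>m n n" by (simp add: transpose_orthogonal_iff[OF A E])
  moreover have "(A\<^sup>T)\<^sup>T * A\<^sup>T = (A\<^sup>T + E\<^sup>T)\<^sup>T * (A\<^sup>T + E\<^sup>T)"
    using gm[folded gram_mates_transpose[OF A E]] by (simp add: gram_mates_def)
  ultimately show "(2 \<cdot>\<^sub>m A + E) * E\<^sup>T = 0\<^sub>m m m"
    using orthogonal_imp_transpose_orthogonal[OF T] transpose_orthogonal_iff[OF T] by simp
qed

text \<open>The way back from conditions (iii) to (v), which do not presuppose Gram mates. Each
  orthogonality relation yields one Gram equation, and \<open>E\<close> being nonzero makes the two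
  matrices distinct.\<close>

lemma gram_matesI:
  assumes A: "A \<in> carrier_mat m n" and E: "E \<in> carrier_mat m n" and "E \<noteq> 0\<^sub>m m n"
    and "zero_one_mat A" "zero_one_mat (A + E)"
    and 1: "(2 \<cdot>\<^sub>m A + E) * E\<^sup>T = 0\<^sub>m m m" and 2: "E\<^sup>T * (2 \<cdot>\<^sub>m A + E) = 0\<^sub>m n n"
  shows "gram_mates A (A + E)"
proof -
  have T: "A\<^sup>T \<in> carrier_mat n m" "E\<^sup>T \<in> carrier_mat n m" using A E by auto
  have "A \<noteq> A + E"
  proof
    assume eq: "A = A + E"
    have "E $$ (i,j) = 0" if "i < m" "j < n" for i j
      using arg_cong[OF eq, of "\<lambda>M. M $$ (i,j)"] that E by simp
    then have "E = 0\<^sub>m m n" using E by (intro eq_matI) auto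
    with assms(3) show False ..
  qed
  moreover have "A\<^sup>T * A = (A + E)\<^sup>T * (A + E)"
    using gram_eq_if_orthogonal[OF T] 2[unfolded transpose_orthogonal_iff[OF A E]]
    unfolding transpose_add[OF A E, symmetric] by simp
  ultimately show ?thesis
    using assms gram_eq_if_orthogonal[OF A E 1] by (simp add: gram_mates_def)
qed

text \<open>The Gram mates witnessing realizability are distinct, and their difference is
  \<open>E\<close>.\<close>

lemma realizable_nonzero:
  assumes E: "E \<in> carrier_mat m n" and "realizable E"
  shows "E \<noteq> 0\<^sub>m m n"
proof -
  obtain B where B: "B \<in> carrier_mat m n" and "gram_mates B (B + E)"
    using assms unfolding realizable_def by auto
  then have "B \<noteq> B + E" by (simp add: gram_mates_def)
  then show ?thesis using B by auto
qed

section \<open>From singular vectors to orthogonality\<close>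

lemma mult_transpose_eq_0_if_on_span:
  fixes X E :: "real mat"
  assumes X: "X \<in> carrier_mat l n" and E: "E \<in> carrier_mat m n" and vs: "set vs \<subseteq> carrier_vec n"
    and span: "LinearCombinations.module.span class_ring (module_vec TYPE(real) n) (set vs) = Row E"
    and 0: "\<And>v. v \<in> set vs \<Longrightarrow> X *\<^sub>v v = 0\<^sub>v l"
  shows "X * E\<^sup>T = 0\<^sub>m l m"
proof -
  interpret vec_space "TYPE(real)" n .
  define W where "W = mat_of_cols n vs"
  have W: "W \<in> carrier_mat n (length vs)" by (simp add: W_def)
  have XW: "X * W = 0\<^sub>m l (length vs)"
  proof (rule eq_matI)
    fix i j assume "i < dim_row (0\<^sub>m l (length vs) :: real mat)" "j < dim_col (0\<^sub>m l (length vs) :: real mat)"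
    then have ij: "i < l" "j < length vs" by auto
    then have "vs ! j \<in> carrier_vec n" using vs nth_mem by blast
    then have "(X * W) $$ (i,j) = (X *\<^sub>v (vs ! j)) $ i" using X ij by (simp add: W_def)
    then show "(X * W) $$ (i,j) = 0\<^sub>m l (length vs) $$ (i,j)" using 0[of "vs ! j"] ij by simp
  qed (use X W in auto)
  have colW: "col_space W = Row E"
    using span cols_mat_of_cols[OF vs] by (simp add: col_space_def W_def)
  have "X *\<^sub>v row E j = 0\<^sub>v l" if "j < m" for j
  proof -
    have "row E j \<in> set (rows E)" using that E by (auto simp: rows_def)
    moreover have "set (rows E) \<subseteq> carrier_vec n" using E by (auto simp: rows_def)
    ultimately have "row E j \<in> Row E"
      using E in_own_span[of "set (rows E)"] by (auto simp: row_space_def)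
    \<comment> \<open>Each row of \<open>E\<close>, that is, each column of
      \<open>E\<^sup>T\<close>, is a combination of the vectors in \<open>vs\<close>, all of which
      \<open>X\<close> kills.\<close>
    then obtain x where x: "x \<in> carrier_vec (length vs)" "W *\<^sub>v x = row E j"
      unfolding colW[symmetric] col_space_eq[OF W] using W by auto
    have "X *\<^sub>v row E j = (X * W) *\<^sub>v x" using assoc_mult_mat_vec[OF X W x(1)] x by simp
    also have "\<dots> = 0\<^sub>v l" unfolding XW using x(1) by (intro eq_vecI) auto
    finally show ?thesis .
  qed
  then have "(X *\<^sub>v row E j) $ i = 0" if "i < l" "j < m" for i j using that by simp
  then have "(X * E\<^sup>T) $$ (i,j) = 0" if "i < l" "j < m" for i j using that X E by simp
  then show ?thesis using X E by (intro eq_matI) auto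
qed

text \<open>The first relation holds because \<open>2A + E\<close> kills a basis of the row space.
  Without a Gram equation, the second must use that the basis consists of singular vectors of
  \<open>A\<close>: this controls \<open>D\<^sup>T * E\<close> on each of them.\<close>

lemma orthogonal_if_right_singular_basis:
  fixes A E :: "real mat"
  assumes A: "A \<in> carrier_mat m n" and E: "E \<in> carrier_mat m n"
    and sing: "\<And>v. v \<in> set vs \<Longrightarrow> right_sing_vec_pos A v"
    and basis: "is_basis_of n vs (Row E)"
    and ker: "\<And>v. v \<in> set vs \<Longrightarrow> (2 \<cdot>\<^sub>m A + E) *\<^sub>v v = 0\<^sub>v m"
  shows "(2 \<cdot>\<^sub>m A + E) * E\<^sup>T = 0\<^sub>m m m \<and> E\<^sup>T * (2 \<cdot>\<^sub>m A + E) = 0\<^sub>m n n"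
proof -
  define D where "D = 2 \<cdot>\<^sub>m A + E"
  have c: "D \<in> carrier_mat m n" "D\<^sup>T \<in> carrier_mat n m" "E\<^sup>T \<in> carrier_mat n m"
    "A\<^sup>T \<in> carrier_mat n m" "D\<^sup>T * E \<in> carrier_mat n n" using A E by (auto simp: D_def)
  have vs: "set vs \<subseteq> carrier_vec n"
    and span: "LinearCombinations.module.span class_ring (module_vec TYPE(real) n) (set vs) = Row E"
    using basis by (auto simp: is_basis_of_def)
  have DE: "D * E\<^sup>T = 0\<^sub>m m m"
    using mult_transpose_eq_0_if_on_span[OF c(1) E vs span] ker by (simp add: D_def)
  have "(D\<^sup>T * E) *\<^sub>v v = 0\<^sub>v n" if vin: "v \<in> set vs" for v
  proof -
    have v: "v \<in> carrier_vec n" using vs vin by auto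
    obtain s u where u: "u \<in> carrier_vec m" and Av: "A *\<^sub>v v = s \<cdot>\<^sub>v u" and Au: "A\<^sup>T *\<^sub>v u = s \<cdot>\<^sub>v v"
      using sing[OF vin] A unfolding right_sing_vec_pos_def by auto
    have Ev: "E *\<^sub>v v \<in> carrier_vec m" using E v by simp
    have "2 \<cdot>\<^sub>m A *\<^sub>v v = 2 \<cdot>\<^sub>v (A *\<^sub>v v)" using A v by (intro eq_vecI) auto
    then have "2 \<cdot>\<^sub>v (A *\<^sub>v v) + E *\<^sub>v v = 0\<^sub>v m"
      using ker[OF vin] add_mult_distrib_mat_vec[of "2 \<cdot>\<^sub>m A" m n E v] A E v by simp
    then have "E *\<^sub>v v = (- 2 * s) \<cdot>\<^sub>v u"
      unfolding Av using u Ev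
      by (intro eq_vecI) (auto simp: vec_eq_iff eq_neg_iff_add_eq_0 add.commute)
    moreover have "D\<^sup>T *\<^sub>v (E *\<^sub>v v) = 2 \<cdot>\<^sub>v (A\<^sup>T *\<^sub>v (E *\<^sub>v v)) + E\<^sup>T *\<^sub>v (E *\<^sub>v v)"
    proof -
      have "D\<^sup>T = 2 \<cdot>\<^sub>m A\<^sup>T + E\<^sup>T"
        unfolding D_def using transpose_add[of "2 \<cdot>\<^sub>m A" m n E] A E by (simp add: transpose_smult_mat)
      moreover have "2 \<cdot>\<^sub>m A\<^sup>T *\<^sub>v (E *\<^sub>v v) = 2 \<cdot>\<^sub>v (A\<^sup>T *\<^sub>v (E *\<^sub>v v))"
        using A Ev E by (intro eq_vecI) auto
      ultimately show ?thesis
        using add_mult_distrib_mat_vec[of "2 \<cdot>\<^sub>m A\<^sup>T" n m "E\<^sup>T" "E *\<^sub>v v"] c Ev by simp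
    qed
    \<comment> \<open>From \<open>D *\<^sub>v v = 0\<^sub>v m\<close> comes
      \<open>E *\<^sub>v v = (- 2 * s) \<cdot>\<^sub>v u\<close>, which
      \<open>2 \<cdot>\<^sub>m A\<^sup>T\<close> sends to a multiple of \<open>v\<close>. Both
      summands are now killed by \<open>D\<close>: the first since \<open>D\<close> kills
      \<open>v\<close>, the second since \<open>D * E\<^sup>T\<close> is zero.\<close>
    ultimately have eq: "D\<^sup>T *\<^sub>v (E *\<^sub>v v) = (2 * (- 2 * s * s)) \<cdot>\<^sub>v v + E\<^sup>T *\<^sub>v (E *\<^sub>v v)"
      using mult_mat_vec[OF c(4) u] Au by (simp add: smult_smult_assoc)
    have EEv: "E\<^sup>T *\<^sub>v (E *\<^sub>v v) \<in> carrier_vec n" using mult_mat_vec_carrier[OF c(3) Ev] .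
    have "D *\<^sub>v (D\<^sup>T *\<^sub>v (E *\<^sub>v v)) =
        (2 * (- 2 * s * s)) \<cdot>\<^sub>v (D *\<^sub>v v) + (D * E\<^sup>T) *\<^sub>v (E *\<^sub>v v)"
      unfolding eq assoc_mult_mat_vec[OF c(1,3) Ev]
      using mult_add_distrib_mat_vec[OF c(1) _ EEv] mult_mat_vec[OF c(1) v] v by simp
    also have "\<dots> = 0\<^sub>v m"
      unfolding DE using ker[OF vin] Ev by (intro eq_vecI) (auto simp: D_def)
    finally have DD: "D *\<^sub>v (D\<^sup>T *\<^sub>v (E *\<^sub>v v)) = 0\<^sub>v m" .
    have y: "D\<^sup>T *\<^sub>v (E *\<^sub>v v) \<in> carrier_vec n" using mult_mat_vec_carrier[OF c(2) Ev] .
    have "(D\<^sup>T *\<^sub>v (E *\<^sub>v v)) \<bullet> (D\<^sup>T *\<^sub>v (E *\<^sub>v v)) = 0"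
      using scalar_prod_mult_mat_vec_transpose[OF c(2) Ev y] DD Ev by simp
    then have "D\<^sup>T *\<^sub>v (E *\<^sub>v v) = 0\<^sub>v n" using scalar_prod_self_eq_0_iff[OF y] by simp
    then show ?thesis using assoc_mult_mat_vec[OF c(2) E v] by simp
  qed
  \<comment> \<open>So far \<open>D\<^sup>T * E\<close> vanishes on the row space of
    \<open>E\<close> only. That suffices, because its product with its own transpose contains
    \<open>D\<^sup>T * E * E\<^sup>T\<close> as a factor.\<close>
  then have 1: "D\<^sup>T * E * E\<^sup>T = 0\<^sub>m n m"
    using mult_transpose_eq_0_if_on_span[OF c(5) E vs span] by simp
  have LT: "(D\<^sup>T * E)\<^sup>T = E\<^sup>T * D" using transpose_mult[OF c(2) E] by simp
  have "(D\<^sup>T * E) * (D\<^sup>T * E)\<^sup>T = D\<^sup>T * E * E\<^sup>T * D"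
    unfolding LT using assoc_mult_mat[OF c(5,3,1)] by simp
  also have "\<dots> = 0\<^sub>m n n" unfolding 1 using c by simp
  finally have "D\<^sup>T * E = 0\<^sub>m n n" by (rule mult_transpose_self_eq_0[OF c(5)])
  then have "E\<^sup>T * D = 0\<^sub>m n n" using LT by simp
  then show ?thesis using DE by (simp add: D_def)
qed

lemma smult_mult_smult_eq_0:
  fixes X Y :: "real mat"
  assumes "X \<in> carrier_mat l m" "Y \<in> carrier_mat m n" "X * Y = 0\<^sub>m l n"
  shows "(a \<cdot>\<^sub>m X) * (b \<cdot>\<^sub>m Y) = 0\<^sub>m l n"
proof -
  have "(a \<cdot>\<^sub>m X) * (b \<cdot>\<^sub>m Y) = a \<cdot>\<^sub>m (b \<cdot>\<^sub>m (X * Y))"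
    using mult_smult_assoc_mat[OF assms(1), of "b \<cdot>\<^sub>m Y" n a] mult_smult_distrib[OF assms(1,2)] assms(2)
    by simp
  then show ?thesis unfolding assms(3) by auto
qed

lemma left_sing_vec_pos_iff: "left_sing_vec_pos A u \<longleftrightarrow> right_sing_vec_pos A\<^sup>T u"
  by (auto simp: left_sing_vec_pos_def right_sing_vec_pos_def)

lemma singular_system_right_sing_vec_pos:
  assumes "singular_system M r s u v" "i < r"
  shows "right_sing_vec_pos M (v i)"
proof -
  note D = singular_systemD[OF carrier_matI[OF refl refl] assms(1)]
  have "u i \<bullet> u i = 1" "v i \<bullet> v i = 1"
    using D(1,2) assms(2) by (auto simp: orthonormal_family_def)
  then show ?thesis
    unfolding right_sing_vec_pos_def using D(3-7) assms(2) by blast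
qed

text \<open>Orthogonality makes \<open>2A + E\<close> vanish on each \<open>v i\<close>, so there
  \<open>A\<close> agrees with \<open>-E/2\<close> and inherits its singular triple.\<close>

lemma singular_system_of_orthogonal:
  fixes A E :: "real mat"
  assumes A: "A \<in> carrier_mat m n" and E: "E \<in> carrier_mat m n"
    and 1: "(2 \<cdot>\<^sub>m A + E) * E\<^sup>T = 0\<^sub>m m m" and 2: "E\<^sup>T * (2 \<cdot>\<^sub>m A + E) = 0\<^sub>m n n"
    and sys: "singular_system ((-1/2) \<cdot>\<^sub>m E) r s u v"
  shows "singular_system A r s u v" "i < r \<Longrightarrow> (2 \<cdot>\<^sub>m A + E) *\<^sub>v v i = 0\<^sub>v m"
proof -
  \<comment> \<open>Stated for arbitrary matrices, because it is applied to \<open>A\<close> and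
    \<open>E\<close> and then to their transposes with \<open>u\<close> and \<open>v\<close>
    exchanged.\<close>
  have *: "(2 \<cdot>\<^sub>m A + E) *\<^sub>v v i = 0\<^sub>v m \<and> A *\<^sub>v v i = s i \<cdot>\<^sub>v u i"
    if A: "A \<in> carrier_mat m n" and E: "E \<in> carrier_mat m n"
      and 1: "(2 \<cdot>\<^sub>m A + E) * E\<^sup>T = 0\<^sub>m m m"
      and sys: "singular_system ((-1/2) \<cdot>\<^sub>m E) r s u v" and i: "i < r" for A E m n u v i
  proof -
    let ?F = "(-1/2) \<cdot>\<^sub>m E" and ?D = "2 \<cdot>\<^sub>m A + E"
    have F: "?F \<in> carrier_mat m n" and D: "?D \<in> carrier_mat m n" using A E by auto
    note sysD = singular_systemD[OF F sys]
    have v: "v i \<in> carrier_vec n" and u: "u i \<in> carrier_vec m" using sysD i by auto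
    have "?D * ?F\<^sup>T = (-1/2) \<cdot>\<^sub>m (?D * E\<^sup>T)"
      unfolding transpose_smult_mat using mult_smult_distrib[OF D, of "E\<^sup>T" m] E by simp
    then have "?D * ?F\<^sup>T = 0\<^sub>m m m" unfolding 1 by auto
    then have Dv: "?D *\<^sub>v v i = 0\<^sub>v m" by (rule mult_singular_vec_eq_0[OF F D _ sys i])
    have "(A *\<^sub>v v i) $ a = s i * u i $ a" if a: "a < m" for a
    proof -
      have "2 * (row A a \<bullet> v i) + row E a \<bullet> v i = 0"
        using arg_cong[OF Dv, of "\<lambda>x. x $ a"] a A E v by (simp add: add_scalar_prod_distrib[of _ n])
      moreover have "(-1/2) * (row E a \<bullet> v i) = s i * u i $ a"
        using arg_cong[OF sysD(6)[OF i], of "\<lambda>x. x $ a"] a E u v by simp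
      ultimately show ?thesis using a A by simp
    qed
    then have "A *\<^sub>v v i = s i \<cdot>\<^sub>v u i" using A u by (intro eq_vecI) auto
    with Dv show ?thesis by simp
  qed
  have T: "A\<^sup>T \<in> carrier_mat n m" "E\<^sup>T \<in> carrier_mat n m" using A E by auto
  show "(2 \<cdot>\<^sub>m A + E) *\<^sub>v v i = 0\<^sub>v m" if "i < r" using *[OF A E 1 sys that] by simp
  have "A\<^sup>T *\<^sub>v u i = s i \<cdot>\<^sub>v v i" if "i < r" for i
    using *[OF T 2[unfolded transpose_orthogonal_iff[OF A E]] _ that, of v u]
      singular_system_transpose[OF sys] by (simp add: transpose_smult_mat)
  then show "singular_system A r s u v"
    using *[OF A E 1 sys] sys A E by (simp add: singular_system_def)
qed

text \<open>The flipped part of the decomposition is itself a decomposition of \<open>-E/2\<close>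
  with the same \<open>U\<close> and \<open>V\<close>, so the flipped values are read off as its
  positive singular values. The orthogonality relations reduce to those of the two diagonal
  parts.\<close>

lemma sign_change_split:
  fixes A E :: "real mat"
  assumes A: "A \<in> carrier_mat m n" and E: "E \<in> carrier_mat m n"
    and wit: "sign_change_witness A (A + E) k U Sig V S"
  obtains Sig1 where "is_svd ((-1/2) \<cdot>\<^sub>m E) U Sig1 V" "flipped_values Sig S = positive_diag Sig1"
    "(2 \<cdot>\<^sub>m A + E) * E\<^sup>T = 0\<^sub>m m m" "E\<^sup>T * (2 \<cdot>\<^sub>m A + E) = 0\<^sub>m n n"
proof -
  have U: "orthogonal_matrix_of m U" and V: "orthogonal_matrix_of n V"
    and Sig: "Sig \<in> carrier_mat m n"
    and off: "\<And>i j. i < m \<Longrightarrow> j < n \<Longrightarrow> i \<noteq> j \<Longrightarrow> Sig $$ (i,j) = 0"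
    and nonneg: "\<And>i. i < min m n \<Longrightarrow> Sig $$ (i,i) \<ge> 0"
    and AU: "A = U * Sig * V\<^sup>T" and flip: "sign_flip_mat k m Sig S" and BU: "A + E = U * S * Sig * V\<^sup>T"
    using wit A unfolding sign_change_witness_def is_svd_def Let_def by auto
  have S: "S \<in> carrier_mat m m" and Soff: "\<And>i j. i < m \<Longrightarrow> j < m \<Longrightarrow> i \<noteq> j \<Longrightarrow> S $$ (i,j) = 0"
    and S1: "\<And>i. i < m \<Longrightarrow> S $$ (i,i) = 1 \<or> S $$ (i,i) = - 1"
    and Spos: "\<And>i. i < m \<Longrightarrow> S $$ (i,i) = - 1 \<Longrightarrow> i < n \<and> Sig $$ (i,i) > 0"
    using flip Sig unfolding sign_flip_mat_def by auto
  have c: "U \<in> carrier_mat m m" "V \<in> carrier_mat n n" "U\<^sup>T \<in> carrier_mat m m" "V\<^sup>T \<in> carrier_mat n n"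
    using U V by (auto simp: orthogonal_matrix_of_def)
  \<comment> \<open>\<open>Sig\<close> is divided by rows, flipped rows going to \<open>Sig1\<close>
    and the others to \<open>Sig0\<close>. In each row one part is zero, so
    \<open>Sig1\<^sup>T * Sig0\<close> vanishes; \<open>Sig0 * Sig1\<^sup>T\<close> vanishes because
    the remaining entries are diagonal.\<close>
  define Sig1 where "Sig1 = mat m n (\<lambda>(i,j). if S $$ (i,i) = - 1 then Sig $$ (i,j) else 0)"
  define Sig0 where "Sig0 = mat m n (\<lambda>(i,j). if S $$ (i,i) = - 1 then 0 else Sig $$ (i,j))"
  have Sc: "Sig0 \<in> carrier_mat m n" "Sig1 \<in> carrier_mat m n" by (auto simp: Sig0_def Sig1_def)
  have sum: "Sig = Sig0 + Sig1" using Sig by (intro eq_matI) (auto simp: Sig0_def Sig1_def)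
  have diff: "S * Sig = Sig0 - Sig1"
  proof (rule eq_matI)
    fix i j assume "i < dim_row (Sig0 - Sig1)" "j < dim_col (Sig0 - Sig1)"
    then have ij: "i < m" "j < n" using Sc by auto
    have "(S * Sig) $$ (i,j) = (\<Sum>b<m. S $$ (i,b) * Sig $$ (b,j))"
      using ij Sig S by (simp add: scalar_prod_def atLeast0LessThan)
    also have "\<dots> = (\<Sum>b<m. if b = i then S $$ (i,b) * Sig $$ (b,j) else 0)"
      using ij Soff by (intro sum.cong) auto
    also have "\<dots> = S $$ (i,i) * Sig $$ (i,j)" using ij by simp
    also have "\<dots> = (Sig0 - Sig1) $$ (i,j)"
      using ij S1[OF ij(1)] by (auto simp: Sig0_def Sig1_def)
    finally show "(S * Sig) $$ (i,j) = (Sig0 - Sig1) $$ (i,j)" .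
  qed (use S Sig Sc in auto)
  define C where "C = U * Sig0 * V\<^sup>T"
  define F where "F = U * Sig1 * V\<^sup>T"
  have US: "U * Sig0 \<in> carrier_mat m n" "U * Sig1 \<in> carrier_mat m n" using c Sc by auto
  have CF: "C \<in> carrier_mat m n" "F \<in> carrier_mat m n" using US c by (auto simp: C_def F_def)
  have A_CF: "A = C + F"
    unfolding AU sum C_def F_def mult_add_distrib_mat[OF c(1) Sc] add_mult_distrib_mat[OF US c(4)] ..
  have B_CF: "A + E = C - F"
    unfolding BU assoc_mult_mat[OF c(1) S Sig] diff C_def F_def
      mult_minus_distrib_mat[OF c(1) Sc] minus_mult_distrib_mat[OF US c(4)] ..
  have Eij: "E $$ (i,j) = - 2 * F $$ (i,j)" if "i < m" "j < n" for i j
    using arg_cong[OF A_CF, of "\<lambda>M. M $$ (i,j)"] arg_cong[OF B_CF, of "\<lambda>M. M $$ (i,j)"] that A E CF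
    by simp
  have EF: "E = (-2) \<cdot>\<^sub>m F" and FE: "(-1/2) \<cdot>\<^sub>m E = F"
    using Eij E CF by (auto intro!: eq_matI)
  have DC: "2 \<cdot>\<^sub>m A + E = 2 \<cdot>\<^sub>m C"
    unfolding EF A_CF using CF by (intro eq_matI) auto
  have "Sig0 * Sig1\<^sup>T = 0\<^sub>m m m"
    using off by (intro eq_matI) (auto simp: Sig0_def Sig1_def scalar_prod_def intro!: sum.neutral, metis)
  then have "C * F\<^sup>T = 0\<^sub>m m m"
    unfolding C_def F_def mult_transpose_two_sided[OF c(1) V Sc] using c by simp
  then have 1: "(2 \<cdot>\<^sub>m A + E) * E\<^sup>T = 0\<^sub>m m m"
    unfolding DC unfolding EF transpose_smult_mat
    by (intro smult_mult_smult_eq_0[of _ m n]) (use CF in auto)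
  have tr: "(U * X * V\<^sup>T)\<^sup>T = V * X\<^sup>T * U\<^sup>T" if X: "X \<in> carrier_mat m n" for X
    using transpose_mult[OF mult_carrier_mat[OF c(1) X] c(4)] transpose_mult[OF c(1) X]
      assoc_mult_mat[OF c(2) _ c(3), of "X\<^sup>T"] X by simp
  have ScT: "Sig1\<^sup>T \<in> carrier_mat n m" "Sig0\<^sup>T \<in> carrier_mat n m" using Sc by auto
  have "Sig1\<^sup>T * (Sig0\<^sup>T)\<^sup>T = 0\<^sub>m n n"
    by (intro eq_matI) (auto simp: Sig0_def Sig1_def scalar_prod_def intro!: sum.neutral)
  then have "F\<^sup>T * (C\<^sup>T)\<^sup>T = 0\<^sub>m n n"
    unfolding C_def F_def tr[OF Sc(1)] tr[OF Sc(2)] mult_transpose_two_sided[OF c(2) U ScT]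
    using c by simp
  then have 2: "E\<^sup>T * (2 \<cdot>\<^sub>m A + E) = 0\<^sub>m n n"
    unfolding DC unfolding EF transpose_smult_mat
    by (intro smult_mult_smult_eq_0[of _ n m]) (use CF in auto)
  have svd: "is_svd ((-1/2) \<cdot>\<^sub>m E) U Sig1 V"
  proof -
    have "\<forall>i<m. \<forall>j<n. i \<noteq> j \<longrightarrow> Sig1 $$ (i,j) = 0" "\<forall>i<min m n. Sig1 $$ (i,i) \<ge> 0"
      using off nonneg by (auto simp: Sig1_def)
    then show ?thesis
      unfolding FE is_svd_def Let_def carrier_matD[OF CF(2)] using U V Sc F_def by blast
  qed
  \<comment> \<open>Flips are allowed only at positive singular values, so every flipped position
    shows up as a positive diagonal entry of \<open>Sig1\<close>.\<close>
  have "{i. i < dim_row S \<and> S $$ (i,i) = - 1} =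
      {i. i < min (dim_row Sig1) (dim_col Sig1) \<and> Sig1 $$ (i,i) > 0}"
    using S Spos by (auto simp: Sig1_def split: if_splits)
  then have "flipped_values Sig S = positive_diag Sig1"
    unfolding flipped_values_def positive_diag_def using S Spos
    by (auto intro!: image_mset_cong simp: Sig1_def split: if_splits)
  then show ?thesis using that svd 1 2 by blast
qed

section \<open>Equivalence of the seven conditions\<close>

theorem theorem3p9:
  fixes A E :: "real mat" and m n k :: nat
  assumes dimA: "A \<in> carrier_mat m n" and dimE: "E \<in> carrier_mat m n"
    and real: "realizable E"
    and rk: "k = vec_space.rank m E"
    and A01: "zero_one_mat A" and AE01: "zero_one_mat (A + E)"
  defines "c1 \<equiv> gram_mates A (A + E) \<and> (2 \<cdot>\<^sub>m A + E) * E\<^sup>T = 0\<^sub>m m m"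
      and "c2 \<equiv> gram_mates A (A + E) \<and> E\<^sup>T * (2 \<cdot>\<^sub>m A + E) = 0\<^sub>m n n"
      and "c3 \<equiv> obtained_by_sign_change A (A + E) k"
      and "c4 \<equiv> (\<exists>vs. length vs = k \<and> (\<forall>v\<in>set vs. right_sing_vec_pos A v) \<and>
                    is_basis_of n vs (Row E) \<and>
                    (\<forall>v\<in>set vs. (2 \<cdot>\<^sub>m A + E) *\<^sub>v v = 0\<^sub>v m))"
      and "c5 \<equiv> (\<exists>us. length us = k \<and> (\<forall>u\<in>set us. left_sing_vec_pos A u) \<and>
                    is_basis_of m us (Col E) \<and>
                    (\<forall>u\<in>set us. (2 \<cdot>\<^sub>m A + E)\<^sup>T *\<^sub>v u = 0\<^sub>v n))"
      and "c6 \<equiv> gram_mates A (A + E) \<and> A * E\<^sup>T = (A * E\<^sup>T)\<^sup>T"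
      and "c7 \<equiv> gram_mates A (A + E) \<and> A\<^sup>T * E = (A\<^sup>T * E)\<^sup>T"
  shows "(c1 \<longleftrightarrow> c2) \<and> (c1 \<longleftrightarrow> c3) \<and> (c1 \<longleftrightarrow> c4) \<and> (c1 \<longleftrightarrow> c5) \<and>
         (c1 \<longleftrightarrow> c6) \<and> (c1 \<longleftrightarrow> c7) \<and>
         (\<forall>U Sig V S U' Sig' V'. sign_change_witness A (A + E) k U Sig V S \<longrightarrow>
              is_svd ((-1/2) \<cdot>\<^sub>m E) U' Sig' V' \<longrightarrow>
              flipped_values Sig S = positive_diag Sig') \<and>
         (c4 \<longrightarrow> (\<exists>vs. length vs = k \<and> (\<forall>v\<in>set vs. right_sing_vec_pos A v) \<and>
                    is_basis_of n vs (Row E) \<and>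
                    (\<forall>v\<in>set vs. (2 \<cdot>\<^sub>m A + E) *\<^sub>v v = 0\<^sub>v m) \<and>
                    (\<forall>v\<in>set vs. right_sing_vec_pos ((-1/2) \<cdot>\<^sub>m E) v))) \<and>
         (c5 \<longrightarrow> (\<exists>us. length us = k \<and> (\<forall>u\<in>set us. left_sing_vec_pos A u) \<and>
                    is_basis_of m us (Col E) \<and>
                    (\<forall>u\<in>set us. (2 \<cdot>\<^sub>m A + E)\<^sup>T *\<^sub>v u = 0\<^sub>v n) \<and>
                    (\<forall>u\<in>set us. left_sing_vec_pos ((-1/2) \<cdot>\<^sub>m E) u)))"
proof -
  define F where "F = (-1/2) \<cdot>\<^sub>m E"
  define D where "D = 2 \<cdot>\<^sub>m A + E"
  have T: "A\<^sup>T \<in> carrier_mat n m" "E\<^sup>T \<in> carrier_mat n m" using dimA dimE by auto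
  have F: "F \<in> carrier_mat m n" using dimE by (simp add: F_def)
  have DT: "D\<^sup>T = 2 \<cdot>\<^sub>m A\<^sup>T + E\<^sup>T"
    unfolding D_def using transpose_add[of "2 \<cdot>\<^sub>m A" m n E] dimA dimE by (simp add: transpose_smult_mat)
  have E0: "E \<noteq> 0\<^sub>m m n" by (rule realizable_nonzero[OF dimE real])
  \<comment> \<open>A single full system of \<open>-E/2\<close> serves throughout: its length is
    \<open>k\<close>, its right vectors form a basis for (iv), its left vectors one for (v), and its
    values are those flipped in (iii).\<close>
  obtain r s u v where full: "full_singular_system F r s u v" using exists_full_singular_system .
  then have sys: "singular_system F r s u v" by (simp add: full_singular_system_def)
  have rowF: "Row F = Row E" and colF: "Col F = Col E"
    unfolding F_def by (simp_all only: Row_smult Col_smult)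
  have rk': "r = k"
    unfolding rk using full_singular_system_rank[OF F full] rank_eq_if_Col_eq[OF F dimE colF] by simp
  have row_basis: "is_basis_of n (map v [0..<k]) (Row E)"
    and col_basis: "is_basis_of m (map u [0..<k]) (Col E)"
    using full_singular_system_row_basis[OF F full] full_singular_system_col_basis[OF F full]
    unfolding rk' rowF colF .
  have c1I: c1 if "D * E\<^sup>T = 0\<^sub>m m m" "E\<^sup>T * D = 0\<^sub>m n n"
    using that gram_matesI[OF dimA dimE E0 A01 AE01] by (simp add: c1_def D_def)
  have c12: "c1 \<longleftrightarrow> c2"
    using gram_mates_orthogonal_iff[OF dimA dimE] by (auto simp: c1_def c2_def)
  have c1D: "D * E\<^sup>T = 0\<^sub>m m m" "E\<^sup>T * D = 0\<^sub>m n n" if c1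
    using that c12 by (auto simp: c1_def c2_def D_def)
  have c16: "c1 \<longleftrightarrow> c6"
    using orthogonal_iff_symmetric[OF dimA dimE] by (auto simp: c1_def c6_def gram_mates_def)
  have "gram_mates A (A + E) \<Longrightarrow> A\<^sup>T * (A\<^sup>T)\<^sup>T = (A\<^sup>T + E\<^sup>T) * (A\<^sup>T + E\<^sup>T)\<^sup>T"
    unfolding gram_mates_def using transpose_add[OF dimA dimE] by (metis transpose_transpose)
  then have c27: "c2 \<longleftrightarrow> c7"
    using orthogonal_iff_symmetric[OF T] transpose_orthogonal_iff[OF dimA dimE]
    by (auto simp: c2_def c7_def)
  have c31: c1
    and flipped: "is_svd ((-1/2) \<cdot>\<^sub>m E) U' Sig' V' \<Longrightarrow> flipped_values Sig S = positive_diag Sig'"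
    if wit: "sign_change_witness A (A + E) k U Sig V S" for U Sig V S U' Sig' V'
  proof -
    obtain Sig1 where "is_svd ((-1/2) \<cdot>\<^sub>m E) U Sig1 V" "flipped_values Sig S = positive_diag Sig1"
      "D * E\<^sup>T = 0\<^sub>m m m" "E\<^sup>T * D = 0\<^sub>m n n"
      unfolding D_def using sign_change_split[OF dimA dimE wit] .
    \<comment> \<open>The sign change provides one decomposition of \<open>-E/2\<close>; uniqueness
      of the positive singular values carries the claim to any other decomposition.\<close>
    then show c1 "is_svd ((-1/2) \<cdot>\<^sub>m E) U' Sig' V' \<Longrightarrow> flipped_values Sig S = positive_diag Sig'"
      using c1I positive_diag_unique[of "(-1/2) \<cdot>\<^sub>m E" U Sig1 V U' Sig' V'] by simp_all
  qed
  have c13: c3 if c1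
  proof -
    define C where "C = (1/2) \<cdot>\<^sub>m D"
    have D: "D \<in> carrier_mat m n" and C: "C \<in> carrier_mat m n"
      using dimA dimE by (auto simp: C_def D_def)
    have "C * F\<^sup>T = 0\<^sub>m m m" "F\<^sup>T * C = 0\<^sub>m n n"
      unfolding C_def F_def transpose_smult_mat
      using smult_mult_smult_eq_0[OF D T(2)] smult_mult_smult_eq_0[OF T(2) D] c1D[OF that] by blast+
    then have "obtained_by_sign_change (F + C) (C - F) k"
      using sign_change_of_orthogonal_sum[OF F C] full rk' by simp
    moreover have "F + C = A" "C - F = A + E"
      using dimA dimE by (auto simp: F_def C_def D_def field_simps intro!: eq_matI)
    ultimately show ?thesis by (simp add: c3_def)
  qed
  \<comment> \<open>These include the bracketed additions to (iv) and (v): the chosen vectors are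
    singular vectors of both \<open>A\<close> and \<open>-E/2\<close>. The additions thus follow
    from (iv) or (v) by passing through (i).\<close>
  have row_ex: "\<exists>vs. length vs = k \<and> (\<forall>v\<in>set vs. right_sing_vec_pos A v) \<and> is_basis_of n vs (Row E) \<and>
      (\<forall>v\<in>set vs. D *\<^sub>v v = 0\<^sub>v m) \<and> (\<forall>v\<in>set vs. right_sing_vec_pos F v)"
    and col_ex: "\<exists>us. length us = k \<and> (\<forall>u\<in>set us. left_sing_vec_pos A u) \<and> is_basis_of m us (Col E) \<and>
      (\<forall>u\<in>set us. D\<^sup>T *\<^sub>v u = 0\<^sub>v n) \<and> (\<forall>u\<in>set us. left_sing_vec_pos F u)" if c1
  proof -
    note o = c1D[OF that, unfolded D_def]
    note o' = o(2)[unfolded transpose_orthogonal_iff[OF dimA dimE]]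
    have FT: "F\<^sup>T = (-1/2) \<cdot>\<^sub>m E\<^sup>T" by (simp add: F_def transpose_smult_mat)
    have o'': "(E\<^sup>T)\<^sup>T * (2 \<cdot>\<^sub>m A\<^sup>T + E\<^sup>T) = 0\<^sub>m m m"
      using o(1) unfolding transpose_orthogonal_iff[OF T] by simp
    note A = singular_system_of_orthogonal[OF dimA dimE o sys[unfolded F_def]]
    note AT = singular_system_of_orthogonal[OF T o' o'' singular_system_transpose[OF sys, unfolded FT]]
    show "\<exists>vs. length vs = k \<and> (\<forall>v\<in>set vs. right_sing_vec_pos A v) \<and> is_basis_of n vs (Row E) \<and>
      (\<forall>v\<in>set vs. D *\<^sub>v v = 0\<^sub>v m) \<and> (\<forall>v\<in>set vs. right_sing_vec_pos F v)"
      using row_basis A(2) singular_system_right_sing_vec_pos[OF A(1)]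
        singular_system_right_sing_vec_pos[OF sys] rk'
      by (intro exI[of _ "map v [0..<k]"]) (auto simp: D_def)
    show "\<exists>us. length us = k \<and> (\<forall>u\<in>set us. left_sing_vec_pos A u) \<and> is_basis_of m us (Col E) \<and>
      (\<forall>u\<in>set us. D\<^sup>T *\<^sub>v u = 0\<^sub>v n) \<and> (\<forall>u\<in>set us. left_sing_vec_pos F u)"
      unfolding left_sing_vec_pos_iff
      using col_basis AT(2) singular_system_right_sing_vec_pos[OF AT(1)]
        singular_system_right_sing_vec_pos[OF singular_system_transpose[OF sys]] rk'
      by (intro exI[of _ "map u [0..<k]"]) (auto simp: DT)
  qed
  have c41: c1 if c4
    using that orthogonal_if_right_singular_basis[OF dimA dimE] c1I unfolding c4_def D_def by blast
  have c51: c1 if c5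
  proof -
    obtain us where us: "\<forall>u\<in>set us. left_sing_vec_pos A u" "is_basis_of m us (Col E)"
      "\<forall>u\<in>set us. D\<^sup>T *\<^sub>v u = 0\<^sub>v n"
      using \<open>c5\<close> unfolding c5_def D_def by blast
    \<comment> \<open>Condition (v) is condition (iv) for the transposed matrices.\<close>
    have "Col E = Row E\<^sup>T" by (simp add: vec_space.col_space_eq_row_space_transpose)
    then have "(2 \<cdot>\<^sub>m A\<^sup>T + E\<^sup>T) * (E\<^sup>T)\<^sup>T = 0\<^sub>m n n" "(E\<^sup>T)\<^sup>T * (2 \<cdot>\<^sub>m A\<^sup>T + E\<^sup>T) = 0\<^sub>m m m"
      using orthogonal_if_right_singular_basis[OF T, of us] us DT
      by (auto simp: left_sing_vec_pos_iff)
    then show ?thesis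
      using c1I transpose_orthogonal_iff[OF dimA dimE] transpose_orthogonal_iff[OF T]
      by (simp add: D_def)
  qed
  have "c1 \<longleftrightarrow> c3" using c13 c31 unfolding c3_def obtained_by_sign_change_def by blast
  moreover have "c1 \<longleftrightarrow> c4" using c41 row_ex unfolding c4_def D_def by blast
  moreover have "c1 \<longleftrightarrow> c5" using c51 col_ex unfolding c5_def D_def by blast
  ultimately show ?thesis
    using c12 c16 c27 flipped row_ex col_ex unfolding D_def F_def by blast
qed

end
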